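(* Let $d \in \mathbb{N}$ be any power of $2$. For all sufficiently large $n$, there exists a Boolean function $F:\{0,1\}^{2n}\to\{0,1\}$ such that $$\gamma_{2d,2}(F) \ge \frac{3}{4} - o(1) \quad\text{and}\quad \gamma_{3d-1,1}(F) \le \frac{5}{8} + o(1),$$ where the $o(1)$ terms tend to $0$ as $n\to\infty$ (with $d$ fixed).
   Context: For a Boolean function $F:\{0,1\}^m\to\{0,1\}$ and $k\ge 1$, the $k$-lift of $F$ is $F_k:\{0,1\}^m\to \mathbb{Z}/2^k\mathbb{Z}$ with $F_k(x)=0$ if $F(x)=0$ and $F_k(x)=2^{k-1}$ if $F(x)=1$. $\mathcal{P}_{d,k}$ denotes the set of multilinear polynomials in the $m$ input variables of degree at most $d$ with coefficients in $\mathbb{Z}/2^k\mathbb{Z}$, evaluated on $\{0,1\}^m$. $\mathrm{agr}(F,G)=\Pr_{x}[F(x)=G(x)]$ for $x$ uniform on the domain, and $\gamma_{d,k}(F)=\max_{Q\in\mathcal{P}_{d,k}}\mathrm{agr}(F_k,Q)$. *)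

theory Defs
  imports "HOL-Probability.Probability"
begin

definition cube :: "nat \<Rightarrow> (nat \<Rightarrow> int) set" where
  "cube m = {..<m} \<rightarrow>\<^sub>E {0, 1}"

text \<open>The ring \<open>\<int>/2\<^sup>k\<int>\<close> is represented by the residues \<open>{0..<2 ^ k}\<close> of type \<^typ>\<open>int\<close>; all
  values compared below are reduced to this range, so equality in the ring is equality of integers.\<close>

definition lift :: "nat \<Rightarrow> ((nat \<Rightarrow> int) \<Rightarrow> int) \<Rightarrow> (nat \<Rightarrow> int) \<Rightarrow> int" where
  "lift k F x = (if F x = 0 then 0 else 2 ^ (k - 1))"

text \<open>A multilinear polynomial in the variables with indices \<open>i < m\<close> is given by its coefficients:
  \<open>c S\<close> is the coefficient of the monomial \<open>\<Prod>i\<in>S. x i\<close>.\<close>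

definition mlpolys :: "nat \<Rightarrow> nat \<Rightarrow> nat \<Rightarrow> (nat set \<Rightarrow> int) set" where
  "mlpolys m d k = {c. (\<forall>S. c S \<in> {0..<2 ^ k}) \<and> (\<forall>S. c S \<noteq> 0 \<longrightarrow> S \<subseteq> {..<m} \<and> card S \<le> d)}"

definition mleval :: "nat \<Rightarrow> nat \<Rightarrow> (nat set \<Rightarrow> int) \<Rightarrow> (nat \<Rightarrow> int) \<Rightarrow> int" where
  "mleval m k c x = (\<Sum>S\<in>Pow {..<m}. c S * (\<Prod>i\<in>S. x i)) mod 2 ^ k"

definition agr :: "nat \<Rightarrow> ((nat \<Rightarrow> int) \<Rightarrow> int) \<Rightarrow> ((nat \<Rightarrow> int) \<Rightarrow> int) \<Rightarrow> real" where
  "agr m F G = measure_pmf.prob (pmf_of_set (cube m)) {x. F x = G x}"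

definition gamma :: "nat \<Rightarrow> nat \<Rightarrow> nat \<Rightarrow> ((nat \<Rightarrow> int) \<Rightarrow> int) \<Rightarrow> real" where
  "gamma m d k F = Max ((\<lambda>Q. agr m (lift k F) (mleval m k Q)) ` mlpolys m d k)"

lemma finite_cube: "finite (cube m)"
  by (auto simp: cube_def intro: finite_PiE)

lemma cube_nonempty: "cube m \<noteq> {}"
  by (simp add: cube_def PiE_eq_empty_iff)

lemma card_cube: "card (cube m) = 2 ^ m"
  by (simp add: cube_def card_PiE numeral_2_eq_2)

lemma finite_mlpolys: "finite (mlpolys m d k)"
proof (rule finite_subset)
  show "mlpolys m d k \<subseteq>
      {c. \<forall>S. (S \<in> Pow {..<m} \<longrightarrow> c S \<in> {0..<2 ^ k}) \<and> (S \<notin> Pow {..<m} \<longrightarrow> c S = 0)}"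
    by (auto simp: mlpolys_def)
  show "finite {c. \<forall>S. (S \<in> Pow {..<m} \<longrightarrow> c S \<in> {0..<(2::int) ^ k}) \<and> (S \<notin> Pow {..<m} \<longrightarrow> c S = 0)}"
    by (rule finite_set_of_finite_funs) auto
qed

lemma mlpolys_nonempty: "mlpolys m d k \<noteq> {}"
proof -
  have "(\<lambda>_. 0) \<in> mlpolys m d k" by (simp add: mlpolys_def)
  then show ?thesis by blast
qed

end

theory Submission
  imports Defs "HOL-Library.Ramsey" "HOL-Number_Theory.Cong"
begin

text \<open>
  Write \<open>S\<^sub>e\<close> for the elementary symmetric polynomial of degree \<open>e\<close> and take
  \<open>F(x, y) = S\<^sub>d(x) S\<^sub>2\<^sub>d(y) + S\<^sub>2\<^sub>d(x) S\<^sub>d(y)\<close> over the two-element field. Since \<open>d\<close> is a power of 2,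
  \<open>S\<^sub>d(x) = 2 S\<^sub>2\<^sub>d(x)\<close> modulo 4 whenever \<open>S\<^sub>d(x)\<close> is even, so \<open>S\<^sub>d(x) S\<^sub>d(y)\<close> agrees with the 2-lift of
  \<open>F\<close> unless \<open>S\<^sub>d(x)\<close> and \<open>S\<^sub>d(y)\<close> are both odd, an event of probability about 1/4.

  For the upper bound let \<open>P\<close> have degree less than \<open>3 d\<close>. Averaging over the values of all other
  variables, it suffices to bound the bias of \<open>F + P\<close> on subcubes. Iterating Ramsey's theorem gives
  subcubes on which \<open>F + P\<close> is symmetric in both halves, with an unchanged part of degree \<open>3 d\<close>.
  The two weights are nearly uniform modulo \<open>4 d\<close>. If \<open>a\<close>, \<open>b\<close> are the binary digits of the weight
  of \<open>x\<close> with values \<open>d\<close>, \<open>2 d\<close>, and \<open>a'\<close>, \<open>b'\<close> those of \<open>y\<close>, then for fixed lower digits \<open>F + P\<close> is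
  \<open>a b' + a' b\<close> plus a combination of \<open>1, a, a', b, b', a a'\<close>; summing over \<open>b\<close> and \<open>b'\<close> kills
  everything except one choice of \<open>(a, a')\<close>, so the bias is at most \<open>1/4 + o(1)\<close>.
\<close>

section \<open>Binomial coefficients modulo 2 and 4\<close>

text \<open>Absorption gives \<open>i * (2 ^ j choose i)\<close> as a multiple of
  \<open>2 ^ j\<close>. An odd binomial would be coprime to \<open>2 ^ j\<close>, so
  \<open>2 ^ j\<close> would divide \<open>i\<close>.\<close>

lemma even_choose_power2:
  fixes i j :: nat
  assumes "0 < i" "i < 2 ^ j"
  shows "even (2 ^ j choose i)"
proof (rule ccontr)
  assume "odd (2 ^ j choose i)"
  then have cop: "coprime (2 ^ j :: nat) (2 ^ j choose i)"
    by simp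
  have "i * (2 ^ j choose i) = 2 ^ j * ((2 ^ j - 1) choose (i - 1))"
    using assms times_binomial_minus1_eq by auto
  then have "2 ^ j dvd i"
    using cop by (metis coprime_dvd_mult_left_iff dvd_triv_left)
  then show False
    using assms by (auto dest: dvd_imp_le)
qed

text \<open>Absorption in row \<open>2 ^ Suc j\<close>, divided by 2: if half the binomial were odd,
  \<open>2 ^ j\<close> would divide \<open>i\<close>.\<close>

lemma four_dvd_choose_power2:
  fixes i j :: nat
  assumes "0 < i" "i < 2 ^ j"
  shows "4 dvd (2 ^ Suc j choose i)"
proof -
  obtain w where w: "2 ^ Suc j choose i = 2 * w"
    using even_choose_power2[of i "Suc j"] assms by auto
  have "even w"
  proof (rule ccontr)
    assume "odd w"
    then have cop: "coprime (2 ^ j :: nat) w"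
      by simp
    have "i * (2 ^ Suc j choose i) = 2 ^ Suc j * ((2 ^ Suc j - 1) choose (i - 1))"
      using assms times_binomial_minus1_eq by auto
    then have "i * w = 2 ^ j * ((2 ^ Suc j - 1) choose (i - 1))"
      unfolding w by simp
    then have "2 ^ j dvd i"
      using cop by (metis coprime_dvd_mult_left_iff dvd_triv_left)
    then show False
      using assms by (auto dest: dvd_imp_le)
  qed
  then show ?thesis
    unfolding w by auto
qed

text \<open>By Pascal's rule two neighbours in this row add up to an interior entry of row
  \<open>2 ^ j\<close>, which is even, so the parity of the first entry 1 propagates along the
  row.\<close>

lemma odd_choose_power2_minus_1:
  fixes i j :: nat
  assumes "i < 2 ^ j"
  shows "odd (2 ^ j - 1 choose i)"
  using assms
proof (induction i)
  case (Suc i)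
  have "2 ^ j choose Suc i = (2 ^ j - 1 choose i) + (2 ^ j - 1 choose Suc i)"
    using choose_reduce_nat[of "2 ^ j" "Suc i"] by simp
  with even_choose_power2[of "Suc i" j] Suc show ?case
    by auto
qed simp

text \<open>Absorption writes the central binomial as twice an entry of row
  \<open>2 ^ Suc j - 1\<close>, and these entries are odd.\<close>

lemma central_choose_power2_mod_4: "[2 ^ Suc j choose 2 ^ j = 2] (mod (4 :: nat))"
proof -
  have "2 ^ j * (2 ^ Suc j choose 2 ^ j) = 2 ^ Suc j * (2 ^ Suc j - 1 choose (2 ^ j - 1))"
    using times_binomial_minus1_eq[of "2 ^ j" "2 ^ Suc j"] by auto
  then have eq: "(2 ^ Suc j choose 2 ^ j) = 2 * (2 ^ Suc j - 1 choose (2 ^ j - 1))"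
    by simp
  have "2 ^ j - 1 < (2 :: nat) ^ Suc j"
    by (simp add: less_imp_diff_less)
  then have "odd (2 ^ Suc j - 1 choose (2 ^ j - 1))"
    by (rule odd_choose_power2_minus_1)
  then obtain b where "2 ^ Suc j choose 2 ^ j = 2 + b * 4"
    unfolding eq by (auto elim!: oddE)
  then show ?thesis
    by (simp only: cong_def mod_mult_self1)
qed

text \<open>This is \<open>(1 + x) ^ d = 1 + x ^ d\<close> modulo 2: in Vandermonde's sum only
  \<open>k = 0\<close> and \<open>k = d\<close> have an odd factor
  \<open>d choose k\<close>.\<close>

lemma choose_add_power2_mod_2:
  fixes u i j :: nat
  defines "d \<equiv> 2 ^ j"
  shows "[(u + d) choose i = (u choose i) + (if d \<le> i then u choose (i - d) else 0)] (mod 2)"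
proof -
  have "[(\<Sum>k\<le>i. (d choose k) * (u choose (i - k))) =
      (\<Sum>k\<le>i. (if k = 0 then u choose i else 0) + (if k = d then u choose (i - d) else 0))] (mod 2)"
  proof (rule cong_sum)
    fix k assume "k \<in> {..i}"
    have "0 < d" by (simp add: d_def)
    consider "k = 0" | "k = d" | "k > d" | "0 < k" "k < d"
      by linarith
    then show "[(d choose k) * (u choose (i - k)) =
        (if k = 0 then u choose i else 0) + (if k = d then u choose (i - d) else 0)] (mod 2)"
    proof cases
      case 4
      then have "even (d choose k)"
        unfolding d_def by (rule even_choose_power2)
      with 4 show ?thesis by (auto simp: cong_0_iff)
    qed (use \<open>0 < d\<close> in \<open>auto simp: binomial_eq_0\<close>)
  qed
  then show ?thesis
    by (simp add: add.commute[of u] vandermonde[of d u i, symmetric] sum.distrib)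
qed

text \<open>Lucas' theorem for the prime 2, in additive form.\<close>

lemma choose_add_mult_power2_mod_2:
  fixes i j l h M :: nat
  defines "d \<equiv> 2 ^ j"
  assumes "i < d * Suc M"
  shows "[(l + d * h) choose i =
    (\<Sum>r\<le>M. (h choose r) * (if d * r \<le> i then l choose (i - d * r) else 0))] (mod 2)"
  using assms(2)
proof (induction h arbitrary: i)
  case 0
  have "(\<Sum>r\<le>M. (0 choose r) * (if d * r \<le> i then l choose (i - d * r) else 0)) =
      (\<Sum>r\<le>M. if r = 0 then l choose i else 0)"
    by (rule sum.cong) (auto simp: gr0_conv_Suc)
  then show ?case by simp
next
  case (Suc h)
  define w where "w r = (if d * r \<le> i then l choose (i - d * r) else 0)" for r
  have w_shift: "w (Suc r) = (if d * r \<le> i - d then l choose (i - d - d * r) else 0)" if "d \<le> i" for r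
    using that by (auto simp: w_def)
  \<comment> \<open>The bound on \<open>i\<close> kills the term \<open>Suc M\<close>, so the sum
    can be extended by it before the index shift that makes Pascal's rule applicable.\<close>
  have w_top: "w (Suc M) = 0"
    using Suc.prems by (auto simp: w_def)
  have "[(l + d * h + d) choose i = (l + d * h choose i) + (if d \<le> i then l + d * h choose (i - d) else 0)] (mod 2)"
    unfolding d_def by (rule choose_add_power2_mod_2)
  also have "[(l + d * h choose i) + (if d \<le> i then l + d * h choose (i - d) else 0) =
      (\<Sum>r\<le>M. (h choose r) * w r) + (\<Sum>r\<le>M. (h choose r) * w (Suc r))] (mod 2)"
  proof (rule cong_add)
    show "[l + d * h choose i = (\<Sum>r\<le>M. (h choose r) * w r)] (mod 2)"
      unfolding w_def using Suc.prems by (rule Suc.IH)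
    show "[(if d \<le> i then l + d * h choose (i - d) else 0) = (\<Sum>r\<le>M. (h choose r) * w (Suc r))] (mod 2)"
    proof (cases "d \<le> i")
      case True
      have "[l + d * h choose (i - d) = (\<Sum>r\<le>M. (h choose r) * w (Suc r))] (mod 2)"
        unfolding w_shift[OF True] by (rule Suc.IH) (use Suc.prems in simp)
      with True show ?thesis by simp
    next
      case False
      then have "w (Suc r) = 0" for r
        by (auto simp: w_def)
      with False show ?thesis by simp
    qed
  qed
  also have "(\<Sum>r\<le>M. (h choose r) * w r) + (\<Sum>r\<le>M. (h choose r) * w (Suc r)) =
      (\<Sum>r\<le>Suc M. (h choose r) * w r) + (\<Sum>r\<le>M. (h choose r) * w (Suc r))"
    by (simp add: w_top)
  also have "\<dots> = (\<Sum>r\<le>Suc M. (Suc h choose r) * w r)"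
    by (simp only: sum.atMost_Suc_shift) (simp add: sum.distrib algebra_simps)
  also have "\<dots> = (\<Sum>r\<le>M. (Suc h choose r) * w r)"
    by (simp add: w_top)
  finally show ?case
    unfolding w_def by (simp add: algebra_simps)
qed

text \<open>Lucas with \<open>i = d\<close>: the term \<open>r = 0\<close> vanishes since
  \<open>u mod d < d\<close>, and \<open>r = 1\<close> contributes \<open>u div d\<close>. So the
  parity is the binary digit of \<open>u\<close> with value \<open>2 ^ j\<close>.\<close>

lemma choose_power2_parity:
  "odd (u choose 2 ^ j) \<longleftrightarrow> odd (u div 2 ^ j)"
proof -
  define d :: nat where "d = 2 ^ j"
  have "[(u mod d + d * (u div d)) choose d =
    (\<Sum>r\<le>1. ((u div d) choose r) * (if d * r \<le> d then (u mod d) choose (d - d * r) else 0))] (mod 2)"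
    unfolding d_def by (rule choose_add_mult_power2_mod_2) simp
  moreover have "(u mod d) choose d = 0"
    by (rule binomial_eq_0) (simp add: d_def)
  ultimately have "[u choose d = u div d] (mod 2)"
    by simp
  then show ?thesis
    by (simp add: d_def[symmetric] cong_def odd_iff_mod_2_eq_one)
qed

text \<open>Adding \<open>2 * d\<close> to the upper index adds 2 modulo 4: in Vandermonde's sum the
  row \<open>2 * d\<close> has entry 1 at \<open>k = 0\<close>, multiples of 4 strictly between 0
  and \<open>d\<close>, and 2 modulo 4 at \<open>k = d\<close>.\<close>

lemma choose_power2_mod_4:
  fixes j m l :: nat
  defines "d \<equiv> 2 ^ j"
  assumes "l < d"
  shows "[(l + 2 * d * m) choose d = 2 * m] (mod 4)"
proof (induction m)
  case 0
  then show ?case using assms by (simp add: binomial_eq_0)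
next
  case (Suc m)
  let ?u = "l + 2 * d * m"
  have "[(\<Sum>k\<le>d. (2 * d choose k) * (?u choose (d - k))) =
      (\<Sum>k\<le>d. (if k = 0 then ?u choose d else 0) + (if k = d then 2 else 0))] (mod 4)"
  proof (rule cong_sum)
    fix k assume "k \<in> {..d}"
    have "0 < d" by (simp add: d_def)
    consider "k = 0" | "k = d" | "0 < k" "k < d"
      using \<open>k \<in> {..d}\<close> by force
    then show "[(2 * d choose k) * (?u choose (d - k)) =
        (if k = 0 then ?u choose d else 0) + (if k = d then 2 else 0)] (mod 4)"
    proof cases
      case 2
      then show ?thesis
        using central_choose_power2_mod_4[of j] \<open>0 < d\<close>
        by (simp add: d_def numeral_2_eq_2)
    next
      case 3
      then have "4 dvd (2 * d choose k)"
        using four_dvd_choose_power2[of k j] by (simp add: d_def)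
      with 3 show ?thesis by (auto simp: cong_0_iff)
    qed (use \<open>0 < d\<close> in auto)
  qed
  then have "[(2 * d + ?u) choose d = (?u choose d) + 2] (mod 4)"
    by (simp add: vandermonde[of "2 * d" ?u d, symmetric] sum.distrib)
  also have "[(?u choose d) + 2 = 2 * m + 2] (mod 4)"
    using Suc by (intro cong_add) auto
  finally show ?case
    by (simp add: algebra_simps)
qed

text \<open>Modulo 4, a polynomial of degree \<open>2 ^ j\<close> thus computes a parity of degree \<open>2 ^ Suc j\<close>; this is
  the gain from working over \<open>\<int>/4\<int>\<close>.\<close>

lemma even_choose_power2_mod_4:
  assumes "even (u choose 2 ^ j)"
  shows "[u choose 2 ^ j = 2 * (u choose 2 ^ Suc j)] (mod 4)"
proof -
  define d :: nat where "d = 2 ^ j"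
  define m where "m = u div (2 * d)"
  have "even (u div d)"
    using assms choose_power2_parity d_def by blast
  then have "u div d = 2 * m"
    unfolding m_def by (metis div_mult2_eq dvd_mult_div_cancel mult.commute)
  then have u: "u = u mod d + 2 * d * m"
    by (metis mod_div_mult_eq mult.assoc mult.commute)
  have "[u choose d = 2 * m] (mod 4)"
    by (subst u, unfold d_def) (rule choose_power2_mod_4, simp)
  moreover have "[u choose (2 * d) = m] (mod 2)"
    using choose_power2_parity[of u "Suc j"] by (simp add: m_def d_def cong_def mod2_eq_if)
  then have "[2 * (u choose (2 * d)) = 2 * m] (mod 4)"
    by (metis cong_cmult_leftI numeral_Bit0 mult_2)
  ultimately show ?thesis
    by (simp add: d_def cong_def)
qed

lemma choose_periodic_mod_2:
  assumes "i < 2 ^ j"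
  shows "[(u mod 2 ^ j) choose i = u choose i] (mod 2)"
proof -
  have "[(u mod 2 ^ j + 2 ^ j * (u div 2 ^ j)) choose i =
     (\<Sum>r\<le>0. ((u div 2 ^ j) choose r) *
       (if 2 ^ j * r \<le> i then (u mod 2 ^ j) choose (i - 2 ^ j * r) else 0))] (mod 2)"
    by (rule choose_add_mult_power2_mod_2) (use assms in simp)
  then show ?thesis by (simp add: cong_sym)
qed

section \<open>Equidistribution of weights\<close>

text \<open>On the unit circle the squared norm of \<open>1 + z\<close> is
  \<open>2 + 2 * Re z\<close>, and \<open>Re z = 1\<close> only at \<open>z = 1\<close>.\<close>

lemma norm_one_plus_less_2:
  fixes z :: complex
  assumes "norm z = 1" "z \<noteq> 1"
  shows "norm (1 + z) < 2"
proof -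
  have sq: "(Re z)\<^sup>2 + (Im z)\<^sup>2 = 1"
    using assms(1) by (metis cmod_power2 one_power2)
  have "Re z < 1"
  proof (rule ccontr)
    assume "\<not> Re z < 1"
    moreover have "Re z \<le> 1"
      using complex_Re_le_cmod[of z] assms(1) by simp
    ultimately show False
      using sq assms(2) by (auto simp: complex_eq_iff)
  qed
  then have "(norm (1 + z))\<^sup>2 < 2\<^sup>2"
    using sq by (simp add: cmod_power2 power2_sum)
  then show ?thesis
    by (rule power2_less_imp_less) simp
qed

text \<open>The probability that a uniformly random subset of an \<open>L\<close>-element set has
  cardinality \<open>\<rho>\<close> modulo \<open>q\<close>.\<close>

definition resid :: "nat \<Rightarrow> nat \<Rightarrow> nat \<Rightarrow> real" where
  "resid q L \<rho> = (\<Sum>k\<le>L. if k mod q = \<rho> then real (L choose k) else 0) / 2 ^ L"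

text \<open>Expand the indicator of a residue class in characters: every nontrivial character contributes
  a factor \<open>((1 + \<omega>) / 2) ^ L\<close>, which decays.\<close>

lemma resid_tendsto:
  assumes "\<rho> < q"
  shows "(\<lambda>L. resid q L \<rho>) \<longlonglongrightarrow> 1 / real q"
proof -
  define e :: "nat \<Rightarrow> complex" where
    "e t = exp (2 * of_real pi * \<i> * of_nat t / of_nat q)" for t
  have q: "1 \<le> q" using assms by simp
  have e_eq: "e s = e t \<longleftrightarrow> s mod q = t mod q" for s t
    unfolding e_def by (rule complex_root_unity_eq[OF q])
  have e_q: "e t ^ q = 1" for t
    unfolding e_def using q by (intro complex_root_unity) auto
  have e_pow: "e t ^ k = e k ^ t" for k t
    by (simp add: e_def flip: exp_of_nat_mult) (simp add: mult_ac)
  have e_0: "e 0 = 1" by (simp add: e_def)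
  have e_nz: "e t \<noteq> 0" for t by (simp add: e_def)
  have norm_e: "norm (e t) = 1" for t
    by (simp add: e_def)
  \<comment> \<open>Orthogonality of characters: by \<open>e_pow\<close> this is a geometric sum
    whose ratio \<open>e k / e \<rho>\<close> is a \<open>q\<close>-th root of unity.\<close>
  have ind: "(\<Sum>t<q. e t ^ k / e t ^ \<rho>) = (if k mod q = \<rho> then of_nat q else 0)" for k
  proof -
    have "(\<Sum>t<q. e t ^ k / e t ^ \<rho>) = (\<Sum>t<q. (e k / e \<rho>) ^ t)"
      by (simp add: e_pow power_divide)
    also have "\<dots> = (if k mod q = \<rho> then of_nat q else 0)"
    proof (cases "k mod q = \<rho>")
      case True
      then have "e k = e \<rho>"
        using assms by (subst e_eq) auto
      then show ?thesis using True e_nz by simp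
    next
      case False
      then have "e k / e \<rho> \<noteq> 1"
        using assms e_nz e_eq by simp
      then have "(\<Sum>t<q. (e k / e \<rho>) ^ t) = ((e k / e \<rho>) ^ q - 1) / (e k / e \<rho> - 1)"
        by (rule geometric_sum)
      then show ?thesis using False by (simp add: power_divide e_q)
    qed
    finally show ?thesis .
  qed
  have res: "complex_of_real (resid q L \<rho>) = (\<Sum>t<q. ((1 + e t) / 2) ^ L / e t ^ \<rho>) / of_nat q" for L
  proof -
    have "(\<Sum>t<q. (1 + e t) ^ L / e t ^ \<rho>) = (\<Sum>t<q. \<Sum>k\<le>L. of_nat (L choose k) * (e t ^ k / e t ^ \<rho>))"
      by (subst add.commute, subst binomial_ring) (simp add: sum_divide_distrib)
    also have "\<dots> = (\<Sum>k\<le>L. of_nat (L choose k) * (\<Sum>t<q. e t ^ k / e t ^ \<rho>))"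
      by (subst sum.swap) (simp add: sum_distrib_left)
    also have "\<dots> = of_nat q * (\<Sum>k\<le>L. if k mod q = \<rho> then of_nat (L choose k) else 0)"
      unfolding ind sum_distrib_left by (rule sum.cong) auto
    also have "\<dots> = of_nat q * complex_of_real (\<Sum>k\<le>L. if k mod q = \<rho> then real (L choose k) else 0)"
      unfolding of_real_sum by (intro arg_cong2[where f = "(*)"] sum.cong) auto
    finally have "complex_of_real (\<Sum>k\<le>L. if k mod q = \<rho> then real (L choose k) else 0) =
        (\<Sum>t<q. (1 + e t) ^ L / e t ^ \<rho>) / of_nat q"
      using q by (simp add: field_simps)
    moreover have "complex_of_real (resid q L \<rho>) =
        complex_of_real (\<Sum>k\<le>L. if k mod q = \<rho> then real (L choose k) else 0) / 2 ^ L"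
      unfolding resid_def by (simp only: of_real_divide of_real_power of_real_numeral)
    ultimately show ?thesis
      by (simp only:) (simp add: power_divide sum_divide_distrib mult_ac)
  qed
  have "(\<lambda>L. (\<Sum>t<q. ((1 + e t) / 2) ^ L / e t ^ \<rho>) / of_nat q)
      \<longlonglongrightarrow> (\<Sum>t<q. if t = 0 then 1 else 0) / of_nat q"
  proof (intro tendsto_divide tendsto_sum tendsto_const)
    fix t assume t: "t \<in> {..<q}"
    show "(\<lambda>L. ((1 + e t) / 2) ^ L / e t ^ \<rho>) \<longlonglongrightarrow> (if t = 0 then 1 else 0)"
    proof (cases "t = 0")
      case False
      then have "e t \<noteq> 1"
        using t e_eq[of t 0] e_0 by simp
      then have "norm ((1 + e t) / 2) < 1"
        using norm_one_plus_less_2[OF norm_e[of t]] by (simp add: norm_divide)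
      then have "(\<lambda>L. ((1 + e t) / 2) ^ L) \<longlonglongrightarrow> 0"
        by (rule LIMSEQ_power_zero)
      then show ?thesis
        using False by (simp add: tendsto_divide_zero)
    qed (simp add: e_0)
  qed (use q in auto)
  then have "(\<lambda>L. complex_of_real (resid q L \<rho>)) \<longlonglongrightarrow> complex_of_real (1 / real q)"
    unfolding res using q by (simp add: lessThan_def)
  then show ?thesis
    by (simp only: tendsto_of_real_iff)
qed

section \<open>Sums over subsets that depend only on the cardinality\<close>

lemma sum_Pow_card:
  fixes h :: "nat \<Rightarrow> 'a :: comm_semiring_1"
  assumes "finite A"
  shows "(\<Sum>X\<in>Pow A. h (card X)) = (\<Sum>k\<le>card A. of_nat (card A choose k) * h k)"
proof -
  have "(\<Sum>X\<in>Pow A. h (card X)) = (\<Sum>k\<le>card A. \<Sum>X\<in>{X \<in> Pow A. card X = k}. h (card X))"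
    by (rule sum.group[symmetric]) (use assms in \<open>auto intro: card_mono\<close>)
  also have "\<dots> = (\<Sum>k\<le>card A. of_nat (card A choose k) * h k)"
    using n_subsets[OF assms] by (intro sum.cong) auto
  finally show ?thesis .
qed

lemma sum_Pow_card_periodic:
  fixes h :: "nat \<Rightarrow> real"
  assumes "finite A" and "0 < q" and "\<And>k. h (k mod q) = h k"
  shows "(\<Sum>X\<in>Pow A. h (card X)) = 2 ^ card A * (\<Sum>\<rho><q. resid q (card A) \<rho> * h \<rho>)"
proof -
  have "(\<Sum>\<rho><q. (\<Sum>k\<le>card A. if k mod q = \<rho> then real (card A choose k) else 0) * h \<rho>)
      = (\<Sum>\<rho><q. \<Sum>k\<le>card A. if k mod q = \<rho> then real (card A choose k) * h (k mod q) else 0)"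
    unfolding sum_distrib_right by (intro sum.cong) auto
  also have "\<dots> = (\<Sum>k\<le>card A. \<Sum>\<rho><q. if k mod q = \<rho> then real (card A choose k) * h (k mod q) else 0)"
    by (rule sum.swap)
  also have "\<dots> = (\<Sum>k\<le>card A. real (card A choose k) * h k)"
    using assms by (intro sum.cong) auto
  also have "\<dots> = (\<Sum>X\<in>Pow A. h (card X))"
    by (rule sum_Pow_card[OF assms(1), symmetric])
  finally show ?thesis
    by (simp add: resid_def sum_distrib_left)
qed

section \<open>Restriction to subcubes\<close>

text \<open>A point of the cube is a pair of sets \<open>X\<close>, \<open>Y\<close>, the supports of its two halves, and
  \<open>c S T\<close> is the coefficient of the monomial \<open>(\<Prod>i\<in>S. x i) * (\<Prod>j\<in>T. y j)\<close>; only parities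
  matter.\<close>

definition peval :: "('a set \<Rightarrow> 'b set \<Rightarrow> nat) \<Rightarrow> 'a set \<Rightarrow> 'b set \<Rightarrow> nat" where
  "peval c X Y = (\<Sum>S\<in>Pow X. \<Sum>T\<in>Pow Y. c S T)"

text \<open>When \<open>c\<close> represents \<open>F + P\<close>, the agreement of \<open>F\<close>
  and \<open>P\<close> is \<open>(1 + bias) / 2\<close>.\<close>

definition bias :: "'a set \<Rightarrow> 'b set \<Rightarrow> ('a set \<Rightarrow> 'b set \<Rightarrow> nat) \<Rightarrow> real" where
  "bias A B c = (\<Sum>X\<in>Pow A. \<Sum>Y\<in>Pow B. (- 1) ^ peval c X Y) / 2 ^ (card A + card B)"

text \<open>The coefficients left after fixing the other variables, those in \<open>X\<close> and
  \<open>Y\<close> to 1 and the rest to 0: a monomial loses its part \<open>R\<close> in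
  \<open>X\<close> and \<open>Q\<close> in \<open>Y\<close>, and the coefficients of equal
  remainders add up.\<close>

definition restrict_poly ::
    "'a set \<Rightarrow> 'b set \<Rightarrow> ('a set \<Rightarrow> 'b set \<Rightarrow> nat) \<Rightarrow> 'a set \<Rightarrow> 'b set \<Rightarrow> nat" where
  "restrict_poly X Y c S T = peval (\<lambda>R Q. c (S \<union> R) (T \<union> Q)) X Y"

text \<open>Symmetry is stated for a single bidegree, so that it can be gained one bidegree at a
  time.\<close>

definition symmetric_at :: "'a set \<Rightarrow> 'b set \<Rightarrow> ('a set \<Rightarrow> 'b set \<Rightarrow> nat) \<Rightarrow> nat \<Rightarrow> nat \<Rightarrow> bool" where
  "symmetric_at A B c i j \<longleftrightarrow>
    (\<exists>g. \<forall>S T. S \<subseteq> A \<and> T \<subseteq> B \<and> card S = i \<and> card T = j \<longrightarrow> c S T mod 2 = g)"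

text \<open>From total degree \<open>3 * d\<close> on, the coefficients have the parity of those of
  \<open>F\<close>; adding a polynomial of degree less than \<open>3 * d\<close> preserves
  this.\<close>

definition leading :: "nat \<Rightarrow> 'a set \<Rightarrow> 'b set \<Rightarrow> ('a set \<Rightarrow> 'b set \<Rightarrow> nat) \<Rightarrow> bool" where
  "leading d A B c \<longleftrightarrow> (\<forall>S T. S \<subseteq> A \<and> T \<subseteq> B \<and> card S + card T \<ge> 3 * d \<longrightarrow>
    (odd (c S T) \<longleftrightarrow> (card S, card T) \<in> {(d, 2 * d), (2 * d, d)}))"

section \<open>Averages over subcubes and the effect of fixing variables\<close>

lemma sum_Pow_Un:
  fixes f :: "'a set \<Rightarrow> 'b :: comm_monoid_add"
  assumes "finite A" "finite B" "A \<inter> B = {}"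
  shows "(\<Sum>X\<in>Pow (A \<union> B). f X) = (\<Sum>X\<in>Pow A. \<Sum>Y\<in>Pow B. f (X \<union> Y))"
proof -
  have "(\<Sum>X\<in>Pow (A \<union> B). f X) = (\<Sum>(X, Y)\<in>Pow A \<times> Pow B. f (X \<union> Y))"
    by (rule sum.reindex_bij_witness[where j = "\<lambda>X. (X \<inter> A, X \<inter> B)" and i = "\<lambda>(X, Y). X \<union> Y"])
      (use assms(3) in \<open>auto intro!: arg_cong[where f = f]\<close>)
  then show ?thesis
    by (simp add: sum.cartesian_product)
qed

lemma peval_Un:
  assumes "finite X" "finite X'" "X \<inter> X' = {}" "finite Y" "finite Y'" "Y \<inter> Y' = {}"
  shows "peval c (X \<union> X') (Y \<union> Y') = peval (restrict_poly X' Y' c) X Y"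
proof -
  have "peval c (X \<union> X') (Y \<union> Y') =
      (\<Sum>S\<in>Pow X. \<Sum>R\<in>Pow X'. \<Sum>T\<in>Pow Y. \<Sum>Q\<in>Pow Y'. c (S \<union> R) (T \<union> Q))"
    by (simp add: peval_def sum_Pow_Un assms)
  also have "\<dots> = (\<Sum>S\<in>Pow X. \<Sum>T\<in>Pow Y. \<Sum>R\<in>Pow X'. \<Sum>Q\<in>Pow Y'. c (S \<union> R) (T \<union> Q))"
    by (intro sum.cong refl sum.swap)
  finally show ?thesis
    by (simp add: peval_def restrict_poly_def)
qed

text \<open>The bias is the average, over all ways to fix the variables outside \<open>A'\<close>
  and \<open>B'\<close>, of the biases of the restrictions.\<close>

lemma bias_le_restrict:
  assumes "finite A" "finite B" "A' \<subseteq> A" "B' \<subseteq> B"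
    and le: "\<And>X Y. X \<subseteq> A - A' \<Longrightarrow> Y \<subseteq> B - B' \<Longrightarrow> bias A' B' (restrict_poly X Y c) \<le> \<beta>"
  shows "bias A B c \<le> \<beta>"
proof -
  define A0 where "A0 = A - A'"
  define B0 where "B0 = B - B'"
  have A: "A = A' \<union> A0" "A' \<inter> A0 = {}" and fA: "finite A'" "finite A0"
    using assms by (auto simp: A0_def intro: finite_subset)
  have B: "B = B' \<union> B0" "B' \<inter> B0 = {}" and fB: "finite B'" "finite B0"
    using assms by (auto simp: B0_def intro: finite_subset)
  have "(\<Sum>X\<in>Pow A. \<Sum>Y\<in>Pow B. (- 1) ^ peval c X Y :: real) =
      (\<Sum>X\<in>Pow A'. \<Sum>X0\<in>Pow A0. \<Sum>Y\<in>Pow B'. \<Sum>Y0\<in>Pow B0. (- 1) ^ peval c (X \<union> X0) (Y \<union> Y0))"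
    unfolding A(1) B(1) by (simp add: sum_Pow_Un A(2) B(2) fA fB)
  also have "\<dots> = (\<Sum>X0\<in>Pow A0. \<Sum>X\<in>Pow A'. \<Sum>Y0\<in>Pow B0. \<Sum>Y\<in>Pow B'. (- 1) ^ peval c (X \<union> X0) (Y \<union> Y0))"
    by (subst sum.swap) (intro sum.cong refl sum.swap)
  also have "\<dots> = (\<Sum>X0\<in>Pow A0. \<Sum>Y0\<in>Pow B0. \<Sum>X\<in>Pow A'. \<Sum>Y\<in>Pow B'. (- 1) ^ peval c (X \<union> X0) (Y \<union> Y0))"
    by (intro sum.cong refl sum.swap)
  also have "\<dots> = (\<Sum>X0\<in>Pow A0. \<Sum>Y0\<in>Pow B0. \<Sum>X\<in>Pow A'. \<Sum>Y\<in>Pow B'.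
      (- 1) ^ peval (restrict_poly X0 Y0 c) X Y)"
  proof (intro sum.cong refl)
    fix X0 Y0 X Y
    assume *: "X0 \<in> Pow A0" "Y0 \<in> Pow B0" "X \<in> Pow A'" "Y \<in> Pow B'"
    have "peval c (X \<union> X0) (Y \<union> Y0) = peval (restrict_poly X0 Y0 c) X Y"
      by (rule peval_Un) (use * A(2) B(2) fA fB in \<open>auto intro: finite_subset\<close>)
    then show "(- 1) ^ peval c (X \<union> X0) (Y \<union> Y0) = ((- 1) ^ peval (restrict_poly X0 Y0 c) X Y :: real)"
      by simp
  qed
  also have "\<dots> = (\<Sum>X0\<in>Pow A0. \<Sum>Y0\<in>Pow B0. 2 ^ (card A' + card B') * bias A' B' (restrict_poly X0 Y0 c))"
    by (simp add: bias_def)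
  also have "\<dots> \<le> (\<Sum>X0\<in>Pow A0. \<Sum>Y0\<in>Pow B0. 2 ^ (card A' + card B') * \<beta>)"
    by (intro sum_mono mult_left_mono le) (auto simp: A0_def B0_def)
  also have "\<dots> = 2 ^ (card A + card B) * \<beta>"
    unfolding A(1) B(1) by (simp add: card_Pow card_Un_disjoint A(2) B(2) fA fB power_add)
  finally show ?thesis
    by (simp add: bias_def divide_le_eq mult.commute)
qed

text \<open>Compare the two sums term by term. The term \<open>R = Q = {}\<close> is covered by
  \<open>base\<close>; every other term has strictly larger total degree and, by disjointness, the
  same bidegree on both sides.\<close>

lemma restrict_poly_cong_mod_2:
  assumes fin: "finite X" "finite Y"
    and disj: "S \<inter> X = {}" "S' \<inter> X = {}" "T \<inter> Y = {}" "T' \<inter> Y = {}"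
    and S: "finite S" "finite S'" "card S = card S'"
    and T: "finite T" "finite T'" "card T = card T'"
    and base: "[c S T = c S' T'] (mod 2)"
    and above: "\<And>R Q R' Q'. R \<subseteq> S \<union> X \<Longrightarrow> Q \<subseteq> T \<union> Y \<Longrightarrow> R' \<subseteq> S' \<union> X \<Longrightarrow> Q' \<subseteq> T' \<union> Y \<Longrightarrow>
      card R = card R' \<Longrightarrow> card Q = card Q' \<Longrightarrow> card R \<ge> card S \<Longrightarrow> card Q \<ge> card T \<Longrightarrow>
      card S + card T < card R + card Q \<Longrightarrow> [c R Q = c R' Q'] (mod 2)"
  shows "[restrict_poly X Y c S T = restrict_poly X Y c S' T'] (mod 2)"
  unfolding restrict_poly_def peval_def
proof (intro cong_sum)
  fix R Q assume "R \<in> Pow X" "Q \<in> Pow Y"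
  then have RQ: "R \<subseteq> X" "Q \<subseteq> Y" and f: "finite R" "finite Q"
    using fin by (auto intro: finite_subset)
  show "[c (S \<union> R) (T \<union> Q) = c (S' \<union> R) (T' \<union> Q)] (mod 2)"
  proof (cases "R = {} \<and> Q = {}")
    case True
    then show ?thesis using base by simp
  next
    case False
    have "S \<inter> R = {}" "S' \<inter> R = {}" "T \<inter> Q = {}" "T' \<inter> Q = {}"
      using disj RQ by blast+
    then have "card (S \<union> R) = card S + card R" "card (S' \<union> R) = card S + card R"
      "card (T \<union> Q) = card T + card Q" "card (T' \<union> Q) = card T + card Q"
      using S T f by (simp_all add: card_Un_disjoint)
    moreover have "card R + card Q > 0"
      using False f by (auto simp: card_gt_0_iff)
    ultimately show ?thesis
      using RQ by (intro above) auto
  qed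
qed

text \<open>Bidegree \<open>(i, j)\<close> itself only involves monomials inside the subcube, but
  the higher monomials merged into it reach the fixed variables, so their symmetry is assumed on all
  of \<open>A\<close> and \<open>B\<close>.\<close>

lemma symmetric_at_restrict:
  assumes fin: "finite A" "finite B" and sub: "A' \<subseteq> A" "B' \<subseteq> B" "X \<subseteq> A - A'" "Y \<subseteq> B - B'"
    and base: "symmetric_at A' B' c i j"
    and above: "\<And>i' j'. i \<le> i' \<Longrightarrow> j \<le> j' \<Longrightarrow> i + j < i' + j' \<Longrightarrow> symmetric_at A B c i' j'"
  shows "symmetric_at A' B' (restrict_poly X Y c) i j"
proof (cases "\<exists>S T. S \<subseteq> A' \<and> T \<subseteq> B' \<and> card S = i \<and> card T = j")
  case True
  then obtain S' T' where S': "S' \<subseteq> A'" "T' \<subseteq> B'" "card S' = i" "card T' = j"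
    by blast
  have fin': "finite A'" "finite B'" "finite X" "finite Y"
    using fin sub by (meson finite_Diff finite_subset)+
  show ?thesis
    unfolding symmetric_at_def
  proof (intro exI[of _ "restrict_poly X Y c S' T' mod 2"] allI impI)
    fix S T assume ST: "S \<subseteq> A' \<and> T \<subseteq> B' \<and> card S = i \<and> card T = j"
    have "[restrict_poly X Y c S T = restrict_poly X Y c S' T'] (mod 2)"
    proof (rule restrict_poly_cong_mod_2)
      show "[c S T = c S' T'] (mod 2)"
        using base ST S' unfolding symmetric_at_def cong_def by metis
      fix R Q R' Q'
      assume *: "R \<subseteq> S \<union> X" "Q \<subseteq> T \<union> Y" "R' \<subseteq> S' \<union> X" "Q' \<subseteq> T' \<union> Y"
        "card R = card R'" "card Q = card Q'" "card R \<ge> card S" "card Q \<ge> card T"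
        "card S + card T < card R + card Q"
      have "symmetric_at A B c (card R) (card Q)"
        using * ST by (intro above) auto
      moreover have "R \<subseteq> A" "Q \<subseteq> B" "R' \<subseteq> A" "Q' \<subseteq> B"
        using * ST S' sub by blast+
      ultimately show "[c R Q = c R' Q'] (mod 2)"
        using *(5,6) unfolding symmetric_at_def cong_def by metis
    qed (use fin' sub ST S' in \<open>auto intro: finite_subset\<close>)
    then show "restrict_poly X Y c S T mod 2 = restrict_poly X Y c S' T' mod 2"
      by (simp add: cong_def)
  qed
qed (auto simp: symmetric_at_def)

lemma symmetric_at_subset:
  assumes "symmetric_at A B c i j" "A' \<subseteq> A" "B' \<subseteq> B"
  shows "symmetric_at A' B' c i j"
proof -
  obtain g where g: "\<And>S T. S \<subseteq> A \<Longrightarrow> T \<subseteq> B \<Longrightarrow> card S = i \<Longrightarrow> card T = j \<Longrightarrow> c S T mod 2 = g"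
    using assms(1) unfolding symmetric_at_def by auto
  show ?thesis
    unfolding symmetric_at_def
    by (intro exI[of _ g] allI impI g) (use assms(2,3) in auto)
qed

text \<open>A monomial that loses a variable while its remainder has degree at least
  \<open>3 * d\<close> had degree above \<open>3 * d\<close>. There all coefficients are even, as
  both exceptional bidegrees have total exactly \<open>3 * d\<close>.\<close>

lemma leading_restrict:
  assumes fin: "finite A" "finite B" and sub: "A' \<subseteq> A" "B' \<subseteq> B" "X \<subseteq> A - A'" "Y \<subseteq> B - B'"
    and lead: "leading d A B c"
  shows "leading d A' B' (restrict_poly X Y c)"
  unfolding leading_def
proof (intro allI impI)
  fix S T assume ST: "S \<subseteq> A' \<and> T \<subseteq> B' \<and> card S + card T \<ge> 3 * d"
  then have fST: "finite S" "finite T"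
    using fin sub by (meson finite_subset subset_trans)+
  have fXY: "finite X" "finite Y"
    using fin sub by (meson finite_Diff finite_subset)+
  have "[restrict_poly X Y c S T = (\<Sum>R\<in>Pow X. \<Sum>Q\<in>Pow Y. if R = {} then if Q = {} then c S T else 0 else 0)] (mod 2)"
    unfolding restrict_poly_def peval_def
  proof (intro cong_sum)
    fix R Q assume RQ: "R \<in> Pow X" "Q \<in> Pow Y"
    then have f: "finite R" "finite Q"
      using fXY by (auto intro: finite_subset)
    show "[c (S \<union> R) (T \<union> Q) = (if R = {} then if Q = {} then c S T else 0 else 0)] (mod 2)"
    proof (cases "R = {} \<and> Q = {}")
      case False
      have "S \<inter> R = {}" "T \<inter> Q = {}"
        using RQ sub ST by blast+
      then have "card (S \<union> R) = card S + card R" "card (T \<union> Q) = card T + card Q"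
        using fST f by (simp_all add: card_Un_disjoint)
      moreover have "card R + card Q > 0"
        using False f by (auto simp: card_gt_0_iff)
      ultimately have "card (S \<union> R) + card (T \<union> Q) > 3 * d"
        using ST by linarith
      moreover have "S \<union> R \<subseteq> A" "T \<union> Q \<subseteq> B"
        using RQ ST sub by auto
      ultimately have "odd (c (S \<union> R) (T \<union> Q)) \<longleftrightarrow>
            (card (S \<union> R), card (T \<union> Q)) \<in> {(d, 2 * d), (2 * d, d)}"
        using lead unfolding leading_def by simp
      then have "even (c (S \<union> R) (T \<union> Q))"
        using \<open>card (S \<union> R) + card (T \<union> Q) > 3 * d\<close> by auto
      then show ?thesis
        using False by (auto simp: cong_0_iff)
    qed auto
  qed
  also have "(\<Sum>R\<in>Pow X. \<Sum>Q\<in>Pow Y. if R = {} then if Q = {} then c S T else 0 else 0) =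
      (\<Sum>R\<in>Pow X. if R = {} then \<Sum>Q\<in>Pow Y. if Q = {} then c S T else 0 else 0)"
    by (intro sum.cong) auto
  also have "\<dots> = c S T"
    using fXY by simp
  finally have "odd (restrict_poly X Y c S T) \<longleftrightarrow> odd (c S T)"
    by (simp add: cong_def odd_iff_mod_2_eq_one)
  also have "\<dots> \<longleftrightarrow> (card S, card T) \<in> {(d, 2 * d), (2 * d, d)}"
  proof -
    have "S \<subseteq> A" "T \<subseteq> B" using ST sub by auto
    then show ?thesis using lead ST unfolding leading_def by blast
  qed
  finally show "odd (restrict_poly X Y c S T) \<longleftrightarrow> (card S, card T) \<in> {(d, 2 * d), (2 * d, d)}" .
qed

section \<open>Symmetrization by Ramsey's theorem\<close>

text \<open>Carries \<open>ramsey_full\<close> from initial segments with numbered colours over to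
  arbitrary finite sets and finite colour sets.\<close>

lemma ramsey_finite_colours:
  fixes r L :: nat and K :: "'c set"
  assumes "finite K"
  shows "\<exists>N. \<forall>(A :: 'a set) col. finite A \<and> N \<le> card A \<and>
    (\<forall>S. S \<subseteq> A \<and> card S = r \<longrightarrow> col S \<in> K) \<longrightarrow>
    (\<exists>H k. H \<subseteq> A \<and> card H = L \<and> (\<forall>S. S \<subseteq> H \<and> card S = r \<longrightarrow> col S = k))"
proof -
  obtain N :: nat where N: "partn_lst {..<N} (replicate (card K) L) r"
    using ramsey_full by blast
  obtain num where num: "bij_betw num K {0..<card K}"
    using ex_bij_betw_finite_nat[OF assms] by blast
  show ?thesis
  proof (rule exI[of _ N], intro allI impI, elim conjE)
    fix A :: "'a set" and col
    assume A: "finite A" "N \<le> card A" and col: "\<forall>S. S \<subseteq> A \<and> card S = r \<longrightarrow> col S \<in> K"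
    obtain A0 where A0: "A0 \<subseteq> A" "card A0 = N" "finite A0"
      using obtain_subset_with_card_n[OF A(2)] by metis
    obtain v where v: "bij_betw v {0..<N} A0"
      using ex_bij_betw_nat_finite[OF A0(3)] A0(2) by blast
    have inj: "inj_on v {..<N}" and img: "v ` {..<N} = A0"
      using v by (auto simp: bij_betw_def lessThan_atLeast0)
    define f where "f S = num (col (v ` S))" for S
    have colK: "col (v ` S) \<in> K" if "S \<in> nsets {..<N} r" for S
    proof -
      have "v ` S \<subseteq> A" "card (v ` S) = r"
        using that img A0(1) inj by (auto simp: nsets_def card_image inj_on_subset)
      then show ?thesis using col by blast
    qed
    have "f \<in> nsets {..<N} r \<rightarrow> {..<card K}"
      using colK num by (force simp: f_def bij_betw_def)
    then obtain i H where i: "i < length (replicate (card K) L)"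
      and H: "H \<in> nsets {..<N} (replicate (card K) L ! i)" "f ` nsets H r \<subseteq> {i}"
      using partn_lstE[OF N] by (metis length_replicate)
    have H': "H \<subseteq> {..<N}" "card H = L" "finite H"
      using H(1) i by (auto simp: nsets_def)
    show "\<exists>H k. H \<subseteq> A \<and> card H = L \<and> (\<forall>S. S \<subseteq> H \<and> card S = r \<longrightarrow> col S = k)"
    proof (rule exI[of _ "v ` H"], rule exI[of _ "inv_into K num i"], intro conjI allI impI)
      show "v ` H \<subseteq> A" using H' img A0 by blast
      show "card (v ` H) = L" using H' inj by (simp add: card_image inj_on_subset)
      fix S assume S: "S \<subseteq> v ` H \<and> card S = r"
      then obtain S0 where S0: "S0 \<subseteq> H" "S = v ` S0"
        by (meson subset_imageE)
      have "card S0 = r"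
        using S S0 H' inj by (metis card_image inj_on_subset subset_trans)
      then have mem: "S0 \<in> nsets H r"
        using S0 H' by (auto simp: nsets_def intro: finite_subset)
      then have "num (col S) = i"
        using H(2) S0(2) by (auto simp: f_def)
      moreover have "col S \<in> K"
        using colK mem S0(2) H'(1) nsets_mono by blast
      ultimately show "col S = inv_into K num i"
        using num by (metis bij_betw_def inv_into_f_f)
    qed
  qed
qed

text \<open>Fix a part of \<open>A\<close> large enough for Ramsey with two colours. Ramsey on
  \<open>B\<close> makes the induced colouring of its subsets independent of \<open>T\<close>;
  Ramsey on that part of \<open>A\<close> then makes this common colouring constant.\<close>

lemma ramsey_bipartite:
  fixes i j L :: nat
  shows "\<exists>N. \<forall>(A :: 'a set) (B :: 'b set) col. finite A \<and> finite B \<and> N \<le> card A \<and> N \<le> card B \<longrightarrow>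
    (\<exists>A' B' b. A' \<subseteq> A \<and> B' \<subseteq> B \<and> card A' = L \<and> card B' = L \<and>
      (\<forall>S T. S \<subseteq> A' \<and> T \<subseteq> B' \<and> card S = i \<and> card T = j \<longrightarrow> col S T = (b :: bool)))"
proof -
  obtain N1 where N1: "\<forall>(A :: 'a set) (col :: 'a set \<Rightarrow> bool). finite A \<and> N1 \<le> card A \<and>
      (\<forall>S. S \<subseteq> A \<and> card S = i \<longrightarrow> col S \<in> UNIV) \<longrightarrow>
      (\<exists>H k. H \<subseteq> A \<and> card H = L \<and> (\<forall>S. S \<subseteq> H \<and> card S = i \<longrightarrow> col S = k))"
    using ramsey_finite_colours[OF finite] by (rule exE)
  txt \<open>A colour for subsets of \<open>B\<close> is a whole colouring of the subsets of \<open>{..<N1}\<close>.\<close>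
  have fin: "finite (Pow (Pow {..<N1}))" by simp
  obtain N2 where N2: "\<forall>(B :: 'b set) (col :: 'b set \<Rightarrow> nat set set). finite B \<and> N2 \<le> card B \<and>
      (\<forall>S. S \<subseteq> B \<and> card S = j \<longrightarrow> col S \<in> Pow (Pow {..<N1})) \<longrightarrow>
      (\<exists>H k. H \<subseteq> B \<and> card H = L \<and> (\<forall>S. S \<subseteq> H \<and> card S = j \<longrightarrow> col S = k))"
    using ramsey_finite_colours[OF fin] by (rule exE)
  show ?thesis
  proof (intro exI[of _ "max N1 N2"] allI impI, elim conjE)
    fix A :: "'a set" and B :: "'b set" and col :: "'a set \<Rightarrow> 'b set \<Rightarrow> bool"
    assume AB: "finite A" "finite B" "max N1 N2 \<le> card A" "max N1 N2 \<le> card B"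
    then obtain A0 where A0: "A0 \<subseteq> A" "card A0 = N1" "finite A0"
      using obtain_subset_with_card_n[of N1 A] by (metis max.bounded_iff)
    obtain v where "bij_betw v {0..<N1} A0"
      using ex_bij_betw_nat_finite[OF A0(3)] A0(2) by blast
    then have img: "v ` {..<N1} = A0"
      by (auto simp: bij_betw_def lessThan_atLeast0)
    have "\<forall>S. S \<subseteq> B \<and> card S = j \<longrightarrow> {S0 \<in> Pow {..<N1}. col (v ` S0) S} \<in> Pow (Pow {..<N1})"
      by blast
    then obtain B' k where B': "B' \<subseteq> B" "card B' = L"
      "\<And>T. T \<subseteq> B' \<Longrightarrow> card T = j \<Longrightarrow> {S \<in> Pow {..<N1}. col (v ` S) T} = k"
      using N2[rule_format, of B "\<lambda>T. {S \<in> Pow {..<N1}. col (v ` S) T}"] AB(2,4) by auto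
    define col' where "col' S \<longleftrightarrow> (\<exists>S0\<in>k. S = v ` S0)" for S
    have col': "col S T = col' S" if "S \<subseteq> A0" "T \<subseteq> B'" "card T = j" for S T
    proof -
      have k: "k = {S \<in> Pow {..<N1}. col (v ` S) T}"
        using B'(3) that by blast
      obtain S0 where "S0 \<subseteq> {..<N1}" "S = v ` S0"
        using \<open>S \<subseteq> A0\<close> img by (metis subset_imageE)
      then show ?thesis
        unfolding col'_def k by auto
    qed
    obtain A' b where A': "A' \<subseteq> A0" "card A' = L" "\<And>S. S \<subseteq> A' \<Longrightarrow> card S = i \<Longrightarrow> col' S = b"
      using N1[rule_format, of A0 col'] A0(2,3) by auto
    show "\<exists>A' B' b. A' \<subseteq> A \<and> B' \<subseteq> B \<and> card A' = L \<and> card B' = L \<and>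
      (\<forall>S T. S \<subseteq> A' \<and> T \<subseteq> B' \<and> card S = i \<and> card T = j \<longrightarrow> col S T = b)"
    proof (rule exI[of _ A'], rule exI[of _ B'], rule exI[of _ b], intro conjI allI impI)
      fix S T assume "S \<subseteq> A' \<and> T \<subseteq> B' \<and> card S = i \<and> card T = j"
      then show "col S T = b"
        using col'[of S T] A' by auto
    qed (use A' A0 B' in auto)
  qed
qed

text \<open>Ramsey's theorem makes the coefficients of bidegree \<open>(i, j)\<close> symmetric on a subcube; a
  restriction to a subcube only adds coefficients of larger total degree, so treating the bidegrees
  in order of decreasing \<open>i + j\<close> keeps the symmetry already gained.\<close>

lemma bias_le_if_symmetric_bias_le:
  fixes \<beta> :: real and L d :: nat and W :: "(nat \<times> nat) set"
  assumes sym: "\<And>(A :: 'a set) (B :: 'b set) c. finite A \<Longrightarrow> finite B \<Longrightarrow> L \<le> card A \<Longrightarrow> L \<le> card B \<Longrightarrow>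
      leading d A B c \<Longrightarrow> (\<And>i j. symmetric_at A B c i j) \<Longrightarrow> bias A B c \<le> \<beta>"
    and W: "finite W" "\<forall>i j i' j'. (i, j) \<in> W \<and> i' \<le> i \<and> j' \<le> j \<longrightarrow> (i', j') \<in> W"
  shows "\<exists>N. \<forall>(A :: 'a set) (B :: 'b set) c. finite A \<and> finite B \<and> N \<le> card A \<and> N \<le> card B \<and>
      leading d A B c \<and> (\<forall>i j. (i, j) \<notin> W \<longrightarrow> symmetric_at A B c i j) \<longrightarrow> bias A B c \<le> \<beta>"
  using W
proof (induction "card W" arbitrary: W)
  case 0
  then have "W = {}" by simp
  then show ?case using sym by (intro exI[of _ L]) auto
next
  case (Suc n)
  then have "W \<noteq> {}" by auto
  \<comment> \<open>A bidegree of maximal total degree in \<open>W\<close>: removing it leaves a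
    downward closed set, so the induction hypothesis applies.\<close>
  then obtain w where w: "w \<in> W" "\<And>w'. w' \<in> W \<Longrightarrow> fst w' + snd w' \<le> fst w + snd w"
    using Max_in[of "(\<lambda>w. fst w + snd w) ` W"] Max_ge[of "(\<lambda>w. fst w + snd w) ` W"] Suc.prems
    by (smt (verit) finite_imageI imageE imageI image_is_empty)
  obtain i j where ij: "w = (i, j)" by fastforce
  have down: "(i', j') \<in> W - {w}" if "(i'', j'') \<in> W - {w}" "i' \<le> i''" "j' \<le> j''" for i' j' i'' j''
  proof -
    have "(i', j') \<noteq> w"
      using that w(2)[of "(i'', j'')"] ij by auto
    then show ?thesis
      using Suc.prems(2) that by blast
  qed
  obtain N1 where N1: "\<forall>(A :: 'a set) (B :: 'b set) c. finite A \<and> finite B \<and> N1 \<le> card A \<and> N1 \<le> card B \<and>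
      leading d A B c \<and> (\<forall>i j. (i, j) \<notin> W - {w} \<longrightarrow> symmetric_at A B c i j) \<longrightarrow> bias A B c \<le> \<beta>"
  proof (rule exE[OF Suc.hyps(1)[of "W - {w}"]])
    show "n = card (W - {w})" "finite (W - {w})"
      using Suc.hyps(2) Suc.prems w(1) by auto
    show "\<forall>i j i' j'. (i, j) \<in> W - {w} \<and> i' \<le> i \<and> j' \<le> j \<longrightarrow> (i', j') \<in> W - {w}"
      using down by blast
  qed
  \<comment> \<open>The homogeneous subcube must have sides of size \<open>N1\<close>, as demanded
    by the induction hypothesis.\<close>
  obtain N where N: "\<forall>(A :: 'a set) (B :: 'b set) col. finite A \<and> finite B \<and> N \<le> card A \<and> N \<le> card B \<longrightarrow>
    (\<exists>A' B' b. A' \<subseteq> A \<and> B' \<subseteq> B \<and> card A' = N1 \<and> card B' = N1 \<and>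
      (\<forall>S T. S \<subseteq> A' \<and> T \<subseteq> B' \<and> card S = i \<and> card T = j \<longrightarrow> col S T = (b :: bool)))"
    using ramsey_bipartite by (rule exE)
  show ?case
  proof (intro exI[of _ N] allI impI, elim conjE)
    fix A :: "'a set" and B :: "'b set" and c
    assume fin: "finite A" "finite B" and card: "N \<le> card A" "N \<le> card B"
      and lead: "leading d A B c" and symW: "\<forall>i j. (i, j) \<notin> W \<longrightarrow> symmetric_at A B c i j"
    obtain A' B' b where sub: "A' \<subseteq> A" "B' \<subseteq> B" and card': "card A' = N1" "card B' = N1"
      and b: "\<And>S T. S \<subseteq> A' \<Longrightarrow> T \<subseteq> B' \<Longrightarrow> card S = i \<Longrightarrow> card T = j \<Longrightarrow> odd (c S T) = b"
      using N[rule_format, of A B "\<lambda>S T. odd (c S T)"] fin card by auto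
    have "c S T mod 2 = of_bool b" if "S \<subseteq> A' \<and> T \<subseteq> B' \<and> card S = i \<and> card T = j" for S T
      using b[of S T] that by (simp add: mod_2_eq_odd)
    then have sym': "symmetric_at A' B' c i j"
      unfolding symmetric_at_def by blast
    show "bias A B c \<le> \<beta>"
    proof (rule bias_le_restrict[OF fin sub])
      fix X Y assume XY: "X \<subseteq> A - A'" "Y \<subseteq> B - B'"
      show "bias A' B' (restrict_poly X Y c) \<le> \<beta>"
      proof (rule N1[rule_format], intro conjI allI impI)
        show "leading d A' B' (restrict_poly X Y c)"
          by (rule leading_restrict[OF fin sub XY lead])
        fix i' j' assume ij': "(i', j') \<notin> W - {w}"
        then have base: "symmetric_at A' B' c i' j'"
          using sym' ij symW sub symmetric_at_subset by blast
        show "symmetric_at A' B' (restrict_poly X Y c) i' j'"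
        proof (rule symmetric_at_restrict[OF fin sub XY base])
          fix i'' j'' assume *: "i' \<le> i''" "j' \<le> j''" "i' + j' < i'' + j''"
          \<comment> \<open>Otherwise downward closure puts \<open>(i', j')\<close> into
            \<open>W\<close>, so it equals \<open>w\<close>, and \<open>(i'', j'')\<close> would
            exceed the maximal total degree.\<close>
          have "(i'', j'') \<notin> W"
          proof
            assume W: "(i'', j'') \<in> W"
            then have "(i', j') \<in> W"
              using Suc.prems(2) * by blast
            then have "(i', j') = w"
              using ij' by blast
            then show False
              using w(2)[OF W] * by auto
          qed
          then show "symmetric_at A B c i'' j''"
            using symW by blast
        qed
      qed (use card' fin sub in \<open>auto intro: finite_subset\<close>)
    qed
  qed
qed

section \<open>The bias of symmetric polynomials\<close>

lemma sum_lessThan_mult: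
  fixes f :: "nat \<Rightarrow> 'a :: comm_monoid_add"
  shows "(\<Sum>u<d * q. f u) = (\<Sum>l<d. \<Sum>h<q. f (l + d * h))"
proof (induction q)
  case (Suc q)
  have "(\<Sum>u<d * Suc q. f u) = (\<Sum>u<d * q. f u) + (\<Sum>u\<in>{d * q..<d * q + d}. f u)"
    unfolding lessThan_atLeast0 by (subst sum.atLeastLessThan_concat) (auto simp: add.commute)
  also have "(\<Sum>u\<in>{d * q..<d * q + d}. f u) = (\<Sum>l<d. f (l + d * q))"
    using sum.shift_bounds_nat_ivl[of f 0 "d * q" d] by (simp add: lessThan_atLeast0 add.commute)
  finally show ?case
    by (simp add: Suc sum.distrib)
qed simp

text \<open>For fixed \<open>h\<close> and \<open>k\<close> modulo 2 the exponent is affine in the second binary digits of \<open>h\<close> and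
  \<open>k\<close>; the sum over these digits vanishes for all but one pair of parities of \<open>h\<close> and \<open>k\<close>.\<close>

lemma sign_sum_le:
  fixes G :: "nat \<Rightarrow> nat \<Rightarrow> nat"
  assumes "\<And>r s. r \<le> 3 \<Longrightarrow> s \<le> 3 \<Longrightarrow> r + s \<ge> 3 \<Longrightarrow> odd (G r s) \<longleftrightarrow> (r, s) \<in> {(1, 2), (2, 1)}"
  shows "(\<Sum>h<4. \<Sum>k<4. (- 1) ^ (\<Sum>r\<le>3. \<Sum>s\<le>3. G r s * (h choose r) * (k choose s))) \<le> (4 :: real)"
proof -
  \<comment> \<open>These ten parities are forced. The other six, at \<open>(0, 0)\<close>,
    \<open>(0, 1)\<close>, \<open>(1, 0)\<close>, \<open>(1, 1)\<close>, \<open>(0, 2)\<close> and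
    \<open>(2, 0)\<close>, are free, and the final simplification covers every combination.\<close>
  have top: "odd (G 1 2)" "odd (G 2 1)" "even (G 0 3)" "even (G 3 0)" "even (G 1 3)" "even (G 3 1)"
    "even (G 2 2)" "even (G 2 3)" "even (G 3 2)" "even (G 3 3)"
    using assms[of 1 2] assms[of 2 1] assms[of 0 3] assms[of 3 0] assms[of 1 3] assms[of 3 1]
      assms[of 2 2] assms[of 2 3] assms[of 3 2] assms[of 3 3] by simp_all
  have lt4: "{..<4} = {0, 1, 2, 3 :: nat}" by auto
  have le3: "{..3} = {0, 1, 2, 3 :: nat}" by auto
  have ch: "(2 choose 2) = (1::nat)" "(3 choose 2) = (3::nat)" "(3 choose 3) = (1::nat)"
    "(2 choose 3) = (0::nat)" "(2 choose 1) = (2::nat)" "(3 choose 1) = (3::nat)"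
    "(1 choose 1) = (1::nat)" "(1 choose 2) = (0::nat)" "(1 choose 3) = (0::nat)"
    "(0 choose 1) = (0::nat)" "(0 choose 2) = (0::nat)" "(0 choose 3) = (0::nat)"
    by (simp_all add: numeral_eq_Suc)
  show ?thesis
    unfolding lt4 le3
    by (simp add: ch top minus_one_power_iff del: One_nat_def binomial_1)
qed

text \<open>Serves to enlarge the index ranges from the weights to a common bound and then to cut
  them down to \<open>3 * d\<close>.\<close>

lemma sum_atMost_truncate_mod_2:
  fixes t :: "nat \<Rightarrow> nat \<Rightarrow> nat"
  assumes "a \<le> M" "b \<le> M" and even: "\<And>i j. a < i \<or> b < j \<Longrightarrow> even (t i j)"
  shows "[(\<Sum>i\<le>M. \<Sum>j\<le>M. t i j) = (\<Sum>i\<le>a. \<Sum>j\<le>b. t i j)] (mod 2)"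
proof -
  have "[(\<Sum>i\<le>M. \<Sum>j\<le>M. t i j) =
      (\<Sum>i\<le>M. \<Sum>j\<le>M. if i \<in> {..a} then if j \<in> {..b} then t i j else 0 else 0)] (mod 2)"
    by (intro cong_sum) (use even in \<open>auto simp: cong_0_iff\<close>)
  also have "(\<Sum>i\<le>M. \<Sum>j\<le>M. if i \<in> {..a} then if j \<in> {..b} then t i j else 0 else 0) =
      (\<Sum>i\<le>M. if i \<in> {..a} then \<Sum>j\<le>M. if j \<in> {..b} then t i j else 0 else 0)"
    by (intro sum.cong) auto
  also have "\<dots> = (\<Sum>i\<in>{..M} \<inter> {..a}. \<Sum>j\<in>{..M} \<inter> {..b}. t i j)"
    by (simp only: sum.inter_restrict finite_atMost)
  also have "\<dots> = (\<Sum>i\<le>a. \<Sum>j\<le>b. t i j)"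
    using assms(1,2) by (simp add: Int_absorb1)
  finally show ?thesis .
qed

text \<open>With symmetric coefficients only the number of monomials of each bidegree matters, and
  inside \<open>X\<close>, \<open>Y\<close> it is a product of two binomials.\<close>

lemma peval_symmetric:
  assumes fin: "finite A" "finite B" and card: "3 * d \<le> card A" "3 * d \<le> card B"
    and lead: "leading d A B c" and sym: "\<And>i j. symmetric_at A B c i j"
  obtains g where
    "\<And>i j. i \<le> 3 * d \<Longrightarrow> j \<le> 3 * d \<Longrightarrow> 3 * d \<le> i + j \<Longrightarrow>
      odd (g i j) \<longleftrightarrow> (i, j) \<in> {(d, 2 * d), (2 * d, d)}"
    "\<And>X Y. X \<subseteq> A \<Longrightarrow> Y \<subseteq> B \<Longrightarrow>
      [peval c X Y = (\<Sum>i\<le>3 * d. \<Sum>j\<le>3 * d. g i j * (card X choose i) * (card Y choose j))] (mod 2)"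
proof -
  obtain g where g: "\<And>i j S T. S \<subseteq> A \<Longrightarrow> T \<subseteq> B \<Longrightarrow> card S = i \<Longrightarrow> card T = j \<Longrightarrow> c S T mod 2 = g i j"
    using sym unfolding symmetric_at_def by metis
  \<comment> \<open>\<open>g i j\<close> is determined only if sets of these sizes exist. The lower
    bounds on the cardinalities guarantee this for all indices up to \<open>3 * d\<close>.\<close>
  have odd_g: "odd (g i j) \<longleftrightarrow> (i, j) \<in> {(d, 2 * d), (2 * d, d)}"
    if ij: "i \<le> card A" "j \<le> card B" "3 * d \<le> i + j" for i j
  proof -
    obtain S where S: "S \<subseteq> A" "card S = i"
      using obtain_subset_with_card_n[OF ij(1)] by metis
    obtain T where T: "T \<subseteq> B" "card T = j"
      using obtain_subset_with_card_n[OF ij(2)] by metis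
    have "odd (c S T) \<longleftrightarrow> (i, j) \<in> {(d, 2 * d), (2 * d, d)}"
      using lead S T ij(3) unfolding leading_def by metis
    moreover have "odd (g i j) \<longleftrightarrow> odd (c S T)"
      using g[OF S(1) T(1) S(2) T(2)] by (metis dvd_mod_iff dvd_refl)
    ultimately show ?thesis by blast
  qed
  have eval: "[peval c X Y = (\<Sum>i\<le>3 * d. \<Sum>j\<le>3 * d. g i j * (card X choose i) * (card Y choose j))] (mod 2)"
    if XY: "X \<subseteq> A" "Y \<subseteq> B" for X Y
  proof -
    define u v where "u = card X" and "v = card Y"
    define t where "t i j = g i j * (u choose i) * (v choose j)" for i j
    define M where "M = max (3 * d) (max u v)"
    have fXY: "finite X" "finite Y"
      using XY fin by (auto intro: finite_subset)
    have uv: "u \<le> card A" "v \<le> card B"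
      using fin XY by (simp_all add: u_def v_def card_mono)
    have "[peval c X Y = (\<Sum>S\<in>Pow X. \<Sum>T\<in>Pow Y. g (card S) (card T))] (mod 2)"
      unfolding peval_def
    proof (intro cong_sum)
      fix S T assume "S \<in> Pow X" "T \<in> Pow Y"
      then have "c S T mod 2 = g (card S) (card T)"
        using XY by (intro g) auto
      then show "[c S T = g (card S) (card T)] (mod 2)"
        by (metis cong_mod_right cong_refl)
    qed
    also have "(\<Sum>S\<in>Pow X. \<Sum>T\<in>Pow Y. g (card S) (card T)) = (\<Sum>i\<le>u. \<Sum>j\<le>v. t i j)"
      unfolding t_def u_def v_def sum_Pow_card[OF fXY(2)]
      by (subst sum_Pow_card[OF fXY(1), where h = "\<lambda>i. \<Sum>j\<le>card Y. of_nat (card Y choose j) * g i j"])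
        (simp add: sum_distrib_left mult_ac)
    also have "[(\<Sum>i\<le>u. \<Sum>j\<le>v. t i j) = (\<Sum>i\<le>M. \<Sum>j\<le>M. t i j)] (mod 2)"
      by (rule cong_sym, rule sum_atMost_truncate_mod_2) (auto simp: M_def t_def binomial_eq_0)
    also have "[(\<Sum>i\<le>M. \<Sum>j\<le>M. t i j) = (\<Sum>i\<le>3 * d. \<Sum>j\<le>3 * d. t i j)] (mod 2)"
    proof (rule sum_atMost_truncate_mod_2)
      fix i j assume ij: "3 * d < i \<or> 3 * d < j"
      show "even (t i j)"
      proof (cases "i \<le> u \<and> j \<le> v")
        case True
        then have "even (g i j)"
          using odd_g[of i j] ij uv by auto
        then show ?thesis by (simp add: t_def)
      next
        case False
        then have "t i j = 0"
          by (auto simp: t_def)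
        then show ?thesis by simp
      qed
    qed (auto simp: M_def)
    finally show ?thesis
      by (simp add: t_def u_def v_def)
  qed
  show ?thesis
    by (rule that[of g]) (use odd_g card eval in auto)
qed

text \<open>Write \<open>u = l + d * h\<close> and \<open>v = l' + d * k\<close>. For fixed
  \<open>l\<close>, \<open>l'\<close> Lucas' theorem turns the exponent into a polynomial in
  \<open>h\<close>, \<open>k\<close>, and \<open>sign_sum_le\<close> bounds each of the
  \<open>d ^ 2\<close> blocks of 16 signs by 4.\<close>

lemma symmetric_sign_sum_le:
  fixes g :: "nat \<Rightarrow> nat \<Rightarrow> nat" and m :: nat
  defines "d \<equiv> 2 ^ m"
  assumes g: "\<And>i j. i \<le> 3 * d \<Longrightarrow> j \<le> 3 * d \<Longrightarrow> 3 * d \<le> i + j \<Longrightarrow>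
      odd (g i j) \<longleftrightarrow> (i, j) \<in> {(d, 2 * d), (2 * d, d)}"
  shows "(\<Sum>u<4 * d. \<Sum>v<4 * d. (- 1) ^ (\<Sum>i\<le>3 * d. \<Sum>j\<le>3 * d. g i j * (u choose i) * (v choose j)))
    \<le> (4 * real d ^ 2)"
proof -
  define f where "f u v = (\<Sum>i\<le>3 * d. \<Sum>j\<le>3 * d. g i j * (u choose i) * (v choose j))" for u v
  have d: "0 < d" by (simp add: d_def)
  have block: "(\<Sum>h<4. \<Sum>k<4. (- 1) ^ f (l + d * h) (l' + d * k)) \<le> (4 :: real)" for l l'
  proof -
    define w where "w l i r = (if d * r \<le> i then l choose (i - d * r) else 0)" for l i r
    define G where "G r s = (\<Sum>i\<le>3 * d. \<Sum>j\<le>3 * d. g i j * w l i r * w l' j s)" for r s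
    have expand: "[(l + d * h) choose i = (\<Sum>r\<le>3. (h choose r) * w l i r)] (mod 2)"
      if "i \<le> 3 * d" for l h i
    proof -
      have "i < d * Suc 3"
        using that d by simp
      then show ?thesis
        unfolding w_def d_def by (rule choose_add_mult_power2_mod_2)
    qed
    have fG: "[f (l + d * h) (l' + d * k) = (\<Sum>r\<le>3. \<Sum>s\<le>3. G r s * (h choose r) * (k choose s))] (mod 2)" for h k
    proof -
      have "[f (l + d * h) (l' + d * k) = (\<Sum>i\<le>3 * d. \<Sum>j\<le>3 * d. g i j *
          (\<Sum>r\<le>3. (h choose r) * w l i r) * (\<Sum>s\<le>3. (k choose s) * w l' j s))] (mod 2)"
        unfolding f_def by (intro cong_sum cong_mult cong_refl expand) auto
      also have "(\<Sum>i\<le>3 * d. \<Sum>j\<le>3 * d. g i j *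
          (\<Sum>r\<le>3. (h choose r) * w l i r) * (\<Sum>s\<le>3. (k choose s) * w l' j s)) =
          (\<Sum>i\<le>3 * d. \<Sum>j\<le>3 * d. \<Sum>r\<le>3. \<Sum>s\<le>3. g i j * w l i r * w l' j s * (h choose r) * (k choose s))"
        by (intro sum.cong refl) (simp add: sum_distrib_left sum_distrib_right mult_ac)
      also have "\<dots> = (\<Sum>i\<le>3 * d. \<Sum>r\<le>3. \<Sum>s\<le>3. \<Sum>j\<le>3 * d. g i j * w l i r * w l' j s * (h choose r) * (k choose s))"
      proof (rule sum.cong[OF refl])
        fix i
        show "(\<Sum>j\<le>3 * d. \<Sum>r\<le>3. \<Sum>s\<le>3. g i j * w l i r * w l' j s * (h choose r) * (k choose s)) =
          (\<Sum>r\<le>3. \<Sum>s\<le>3. \<Sum>j\<le>3 * d. g i j * w l i r * w l' j s * (h choose r) * (k choose s))"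
          by (subst sum.swap) (intro sum.cong refl sum.swap)
      qed
      also have "\<dots> = (\<Sum>r\<le>3. \<Sum>s\<le>3. \<Sum>i\<le>3 * d. \<Sum>j\<le>3 * d. g i j * w l i r * w l' j s * (h choose r) * (k choose s))"
        by (subst sum.swap) (intro sum.cong refl sum.swap)
      finally show ?thesis
        by (simp add: G_def sum_distrib_right)
    qed
    have G_top: "odd (G r s) \<longleftrightarrow> (r, s) \<in> {(1, 2), (2, 1)}" if rs: "r \<le> 3" "s \<le> 3" "3 \<le> r + s" for r s
    proof -
      have le: "3 * d \<le> d * r + d * s"
        using mult_le_mono2[OF rs(3), of d] by (simp add: algebra_simps)
      have "[G r s = (\<Sum>i\<le>3 * d. \<Sum>j\<le>3 * d. if i = d * r then if j = d * s then g i j else 0 else 0)] (mod 2)"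
        unfolding G_def
      proof (intro cong_sum)
        fix i j assume ij: "i \<in> {..3 * d}" "j \<in> {..3 * d}"
        \<comment> \<open>The first case has both weights \<open>l choose 0 = 1\<close>, the second
          has a zero weight, and the third lies above total degree \<open>3 * d\<close>, where
          \<open>g\<close> is even.\<close>
        consider "i = d * r" "j = d * s" | "i < d * r \<or> j < d * s"
          | "d * r \<le> i" "d * s \<le> j" "d * r + d * s < i + j"
          by linarith
        then show "[g i j * w l i r * w l' j s =
            (if i = d * r then if j = d * s then g i j else 0 else 0)] (mod 2)"
        proof cases
          case 3
          then have "even (g i j)"
            using g[of i j] ij le by auto
          with 3 show ?thesis by (auto simp: cong_0_iff)
        qed (auto simp: w_def)
      qed
      also have "(\<Sum>i\<le>3 * d. \<Sum>j\<le>3 * d. if i = d * r then if j = d * s then g i j else 0 else 0) =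
          (\<Sum>i\<le>3 * d. if i = d * r then \<Sum>j\<le>3 * d. if j = d * s then g i j else 0 else 0)"
        by (intro sum.cong) auto
      also have "\<dots> = g (d * r) (d * s)"
        using rs by simp
      finally have "odd (G r s) \<longleftrightarrow> odd (g (d * r) (d * s))"
        by (simp add: cong_def odd_iff_mod_2_eq_one)
      also have "\<dots> \<longleftrightarrow> (d * r, d * s) \<in> {(d, 2 * d), (2 * d, d)}"
        using rs le by (intro g) auto
      also have "\<dots> \<longleftrightarrow> (r, s) \<in> {(1, 2), (2, 1)}"
        using d by auto
      finally show ?thesis .
    qed
    have "(- 1 :: real) ^ f (l + d * h) (l' + d * k) =
        (- 1) ^ (\<Sum>r\<le>3. \<Sum>s\<le>3. G r s * (h choose r) * (k choose s))" for h k
      using fG[of h k] by (simp add: minus_one_power_iff cong_def even_iff_mod_2_eq_zero)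
    then show ?thesis
      using sign_sum_le[of G] G_top by simp
  qed
  have "(\<Sum>u<4 * d. \<Sum>v<4 * d. (- 1) ^ f u v :: real) =
      (\<Sum>l<d. \<Sum>h<4. \<Sum>l'<d. \<Sum>k<4. (- 1) ^ f (l + d * h) (l' + d * k))"
    by (simp only: mult.commute[of 4] sum_lessThan_mult)
  also have "\<dots> = (\<Sum>l<d. \<Sum>l'<d. \<Sum>h<4. \<Sum>k<4. (- 1) ^ f (l + d * h) (l' + d * k))"
    by (intro sum.cong refl sum.swap)
  also have "\<dots> \<le> (\<Sum>l<d. \<Sum>l'<d. 4)"
    by (intro sum_mono block)
  finally show ?thesis
    by (simp add: f_def power2_eq_square)
qed

lemma symmetric_bias_le:
  fixes \<epsilon> :: real and m :: nat
  defines "d \<equiv> 2 ^ m"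
  assumes "0 < \<epsilon>"
  shows "\<exists>L. \<forall>(A :: 'a set) (B :: 'b set) c. finite A \<and> finite B \<and> L \<le> card A \<and> L \<le> card B \<and>
      leading d A B c \<and> (\<forall>i j. symmetric_at A B c i j) \<longrightarrow> bias A B c \<le> 1 / 4 + \<epsilon>"
proof -
  \<comment> \<open>A power of 2 above \<open>3 * d\<close>, hence a period modulo 2 of all
    binomials that occur.\<close>
  define q where "q = 4 * d"
  have q: "0 < q" by (simp add: q_def d_def)
  \<comment> \<open>Replacing both densities by \<open>1 / q\<close> creates three errors per term,
    two linear and one quadratic. The cap 1 bounds the quadratic one by \<open>\<eta>\<close> too,
    and the \<open>q ^ 2\<close> terms cost at most \<open>\<epsilon>\<close> in total.\<close>
  define \<eta> where "\<eta> = min 1 (\<epsilon> / (3 * real q ^ 2))"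
  have eta: "0 < \<eta>" "\<eta> \<le> 1" "3 * \<eta> * real q ^ 2 \<le> \<epsilon>"
    using assms(2) q by (auto simp: \<eta>_def min_def field_simps)
  have "\<forall>\<rho>\<in>{..<q}. \<forall>\<^sub>F L in sequentially. \<bar>resid q L \<rho> - 1 / q\<bar> < \<eta>"
    using resid_tendsto[THEN tendstoD, OF _ eta(1)] by (auto simp: dist_real_def)
  then have "\<forall>\<^sub>F L in sequentially. \<forall>\<rho>\<in>{..<q}. \<bar>resid q L \<rho> - 1 / q\<bar> < \<eta>"
    by (intro eventually_ball_finite) auto
  then obtain L0 where L0: "\<And>L \<rho>. L0 \<le> L \<Longrightarrow> \<rho> < q \<Longrightarrow> \<bar>resid q L \<rho> - 1 / q\<bar> < \<eta>"
    unfolding eventually_sequentially by auto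
  show ?thesis
  proof (intro exI[of _ "max L0 (3 * d)"] allI impI, elim conjE)
    fix A :: "'a set" and B :: "'b set" and c
    assume fin: "finite A" "finite B" and card: "max L0 (3 * d) \<le> card A" "max L0 (3 * d) \<le> card B"
      and lead: "leading d A B c" and sym: "\<forall>i j. symmetric_at A B c i j"
    have card': "3 * d \<le> card A" "3 * d \<le> card B"
      using card by simp_all
    obtain g where g: "\<And>i j. i \<le> 3 * d \<Longrightarrow> j \<le> 3 * d \<Longrightarrow> 3 * d \<le> i + j \<Longrightarrow>
        odd (g i j) \<longleftrightarrow> (i, j) \<in> {(d, 2 * d), (2 * d, d)}"
      and eval: "\<And>X Y. X \<subseteq> A \<Longrightarrow> Y \<subseteq> B \<Longrightarrow>
        [peval c X Y = (\<Sum>i\<le>3 * d. \<Sum>j\<le>3 * d. g i j * (card X choose i) * (card Y choose j))] (mod 2)"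
      using peval_symmetric[OF fin card' lead sym[rule_format], of thesis] by blast
    define \<sigma> :: "nat \<Rightarrow> nat \<Rightarrow> real" where
      "\<sigma> u v = (- 1) ^ (\<Sum>i\<le>3 * d. \<Sum>j\<le>3 * d. g i j * (u choose i) * (v choose j))" for u v
    have choose_mod: "[(u mod q) choose i = u choose i] (mod 2)" if "i \<le> 3 * d" for u i
    proof -
      have "q = 2 ^ (m + 2)"
        by (simp add: q_def d_def power_add)
      moreover have "i < q"
        using that q unfolding q_def by linarith
      ultimately show ?thesis
        by (simp only: choose_periodic_mod_2)
    qed
    have sigma_cong: "\<sigma> u v = \<sigma> u' v'"
      if "\<And>i. i \<le> 3 * d \<Longrightarrow> [u choose i = u' choose i] (mod 2)"
        "\<And>i. i \<le> 3 * d \<Longrightarrow> [v choose i = v' choose i] (mod 2)" for u v u' v'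
    proof -
      have "[(\<Sum>i\<le>3 * d. \<Sum>j\<le>3 * d. g i j * (u choose i) * (v choose j)) =
          (\<Sum>i\<le>3 * d. \<Sum>j\<le>3 * d. g i j * (u' choose i) * (v' choose j))] (mod 2)"
        by (intro cong_sum cong_mult cong_refl that) auto
      then show ?thesis
        unfolding \<sigma>_def by (simp add: minus_one_power_iff cong_def even_iff_mod_2_eq_zero)
    qed
    have periodic: "\<sigma> (u mod q) v = \<sigma> u v" "\<sigma> u (v mod q) = \<sigma> u v" for u v
      by (rule sigma_cong; simp add: choose_mod)+
    have "(\<Sum>X\<in>Pow A. \<Sum>Y\<in>Pow B. (- 1) ^ peval c X Y :: real) = (\<Sum>X\<in>Pow A. \<Sum>Y\<in>Pow B. \<sigma> (card X) (card Y))"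
    proof (intro sum.cong refl)
      fix X Y assume "X \<in> Pow A" "Y \<in> Pow B"
      then show "(- 1) ^ peval c X Y = \<sigma> (card X) (card Y)"
        unfolding \<sigma>_def using eval[of X Y] by (simp add: minus_one_power_iff cong_def even_iff_mod_2_eq_zero)
    qed
    also have "\<dots> = (\<Sum>X\<in>Pow A. 2 ^ card B * (\<Sum>\<tau><q. resid q (card B) \<tau> * \<sigma> (card X) \<tau>))"
      by (intro sum.cong refl sum_Pow_card_periodic[OF fin(2) q] periodic)
    also have "\<dots> = 2 ^ card A * (\<Sum>\<rho><q. resid q (card A) \<rho> * (2 ^ card B * (\<Sum>\<tau><q. resid q (card B) \<tau> * \<sigma> \<rho> \<tau>)))"
      by (rule sum_Pow_card_periodic[OF fin(1) q]) (simp add: periodic)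
    also have "\<dots> = 2 ^ (card A + card B) *
        (\<Sum>\<rho><q. \<Sum>\<tau><q. resid q (card A) \<rho> * resid q (card B) \<tau> * \<sigma> \<rho> \<tau>)"
      by (simp add: power_add sum_distrib_left mult_ac)
    finally have "bias A B c = (\<Sum>\<rho><q. \<Sum>\<tau><q. resid q (card A) \<rho> * resid q (card B) \<tau> * \<sigma> \<rho> \<tau>)"
      by (simp add: bias_def)
    also have "\<dots> \<le> (\<Sum>\<rho><q. \<Sum>\<tau><q. \<sigma> \<rho> \<tau> / real q ^ 2 + 3 * \<eta>)"
    proof (intro sum_mono)
      fix \<rho> \<tau> assume "\<rho> \<in> {..<q}" "\<tau> \<in> {..<q}"
      define a b where "a = resid q (card A) \<rho> - 1 / q" and "b = resid q (card B) \<tau> - 1 / q"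
      have ab: "\<bar>a\<bar> \<le> \<eta>" "\<bar>b\<bar> \<le> \<eta>"
        using L0[of "card A" \<rho>] L0[of "card B" \<tau>] card \<open>\<rho> \<in> {..<q}\<close> \<open>\<tau> \<in> {..<q}\<close>
        by (auto simp: a_def b_def)
      have "\<bar>a * b\<bar> \<le> \<eta> * 1"
        unfolding abs_mult using ab eta by (intro mult_mono) auto
      moreover have "\<bar>a / q\<bar> \<le> \<eta>" "\<bar>b / q\<bar> \<le> \<eta>"
      proof -
        have "1 \<le> real q" using q by simp
        then have "\<eta> \<le> \<eta> * real q" using eta(1) by (simp add: mult_le_cancel_left1)
        then show "\<bar>a / q\<bar> \<le> \<eta>" "\<bar>b / q\<bar> \<le> \<eta>"
          using ab q by (simp_all add: abs_div_pos[symmetric] divide_le_eq)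
      qed
      ultimately have "\<bar>a * b + a / q + b / q\<bar> \<le> 3 * \<eta>"
        by linarith
      moreover have "\<bar>\<sigma> \<rho> \<tau>\<bar> = 1"
        by (simp add: \<sigma>_def power_abs)
      ultimately have "(a * b + a / q + b / q) * \<sigma> \<rho> \<tau> \<le> 3 * \<eta>"
        by (metis abs_le_D1 abs_mult mult.right_neutral)
      moreover have "resid q (card A) \<rho> * resid q (card B) \<tau> = (a * b + a / q + b / q) + 1 / real q ^ 2"
        using q by (simp add: a_def b_def field_simps power2_eq_square)
      ultimately show "resid q (card A) \<rho> * resid q (card B) \<tau> * \<sigma> \<rho> \<tau> \<le> \<sigma> \<rho> \<tau> / real q ^ 2 + 3 * \<eta>"
        by (simp add: algebra_simps)
    qed
    also have "\<dots> = (\<Sum>\<rho><q. \<Sum>\<tau><q. \<sigma> \<rho> \<tau>) / real q ^ 2 + 3 * \<eta> * real q ^ 2"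
      by (simp add: sum.distrib sum_divide_distrib power2_eq_square)
    also have "\<dots> \<le> (4 * real d ^ 2) / real q ^ 2 + \<epsilon>"
      unfolding \<sigma>_def q_def
      by (intro add_mono divide_right_mono symmetric_sign_sum_le[of m g, folded d_def] g
          eta(3)[unfolded q_def]) auto
    also have "(4 * real d ^ 2) / real q ^ 2 = 1 / 4"
      by (simp add: q_def d_def power_mult_distrib)
    finally show "bias A B c \<le> 1 / 4 + \<epsilon>" .
  qed
qed

lemma leading_bias_le:
  fixes \<epsilon> :: real and m :: nat
  defines "d \<equiv> 2 ^ m"
  assumes "0 < \<epsilon>"
  shows "\<exists>N. \<forall>(A :: 'a set) (B :: 'b set) c. finite A \<and> finite B \<and> N \<le> card A \<and> N \<le> card B \<and>
      leading d A B c \<longrightarrow> bias A B c \<le> 1 / 4 + \<epsilon>"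
proof -
  obtain L where L: "\<forall>(A :: 'a set) (B :: 'b set) c. finite A \<and> finite B \<and> L \<le> card A \<and> L \<le> card B \<and>
      leading d A B c \<and> (\<forall>i j. symmetric_at A B c i j) \<longrightarrow> bias A B c \<le> 1 / 4 + \<epsilon>"
    using symmetric_bias_le[OF assms(2), of m, folded d_def] by (rule exE)
  \<comment> \<open>The bidegrees still to be symmetrized; on all others \<open>leading\<close>
    already fixes the parity.\<close>
  define W where "W = {(i :: nat, j). i + j < 3 * d}"
  have "W \<subseteq> {..<3 * d} \<times> {..<3 * d}"
    by (auto simp: W_def)
  then have "finite W"
    by (rule finite_subset) simp
  obtain N where N: "\<forall>(A :: 'a set) (B :: 'b set) c. finite A \<and> finite B \<and> N \<le> card A \<and> N \<le> card B \<and>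
      leading d A B c \<and> (\<forall>i j. (i, j) \<notin> W \<longrightarrow> symmetric_at A B c i j) \<longrightarrow> bias A B c \<le> 1 / 4 + \<epsilon>"
  proof (rule exE[OF bias_le_if_symmetric_bias_le[where W = W and L = L and d = d and \<beta> = "1 / 4 + \<epsilon>"]])
    show "\<forall>i j i' j'. (i, j) \<in> W \<and> i' \<le> i \<and> j' \<le> j \<longrightarrow> (i', j') \<in> W"
      by (auto simp: W_def)
  qed (use L \<open>finite W\<close> in auto)
  show ?thesis
  proof (intro exI[of _ N] allI impI, elim conjE)
    fix A :: "'a set" and B :: "'b set" and c
    assume *: "finite A" "finite B" "N \<le> card A" "N \<le> card B" "leading d A B c"
    have "symmetric_at A B c i j" if "(i, j) \<notin> W" for i j
      unfolding symmetric_at_def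
    proof (intro exI allI impI, elim conjE)
      fix S T assume "S \<subseteq> A" "T \<subseteq> B" "card S = i" "card T = j"
      then have "odd (c S T) \<longleftrightarrow> (i, j) \<in> {(d, 2 * d), (2 * d, d)}"
        using *(5) that unfolding leading_def W_def by auto
      then show "c S T mod 2 = of_bool ((i, j) \<in> {(d, 2 * d), (2 * d, d)})"
        by (simp add: mod_2_eq_odd)
    qed
    then show "bias A B c \<le> 1 / 4 + \<epsilon>"
      using N * by blast
  qed
qed

section \<open>Agreement with polynomials\<close>

text \<open>The indicator function of \<open>Z\<close>, restricted to \<open>{..<m}\<close> because
  \<open>cube m\<close> consists of extensional functions.\<close>

definition point :: "nat \<Rightarrow> nat set \<Rightarrow> nat \<Rightarrow> int" where
  "point m Z = (\<lambda>i\<in>{..<m}. if i \<in> Z then 1 else 0)"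

lemma bij_betw_point: "bij_betw (point m) (Pow {..<m}) (cube m)"
proof (rule bij_betw_byWitness[where f' = "\<lambda>x. {i. i < m \<and> x i = 1}"])
  show "\<forall>Z\<in>Pow {..<m}. {i. i < m \<and> point m Z i = 1} = Z"
    by (auto simp: point_def)
  show "\<forall>x\<in>cube m. point m {i. i < m \<and> x i = 1} = x"
  proof
    fix x assume x: "x \<in> cube m"
    show "point m {i. i < m \<and> x i = 1} = x"
    proof
      fix i
      show "point m {i. i < m \<and> x i = 1} i = x i"
        using x by (cases "i < m") (auto simp: point_def cube_def PiE_def extensional_def Pi_def)
    qed
  qed
  show "point m ` Pow {..<m} \<subseteq> cube m"
    by (intro image_subsetI) (simp add: point_def cube_def)
  show "(\<lambda>x. {i. i < m \<and> x i = 1}) ` cube m \<subseteq> Pow {..<m}"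
    by auto
qed

lemma agr_eq_sum:
  "agr m F G = (\<Sum>Z\<in>Pow {..<m}. of_bool (F (point m Z) = G (point m Z))) / 2 ^ m"
proof -
  have "agr m F G = card (cube m \<inter> {x. F x = G x}) / card (cube m)"
    unfolding agr_def by (rule measure_pmf_of_set[OF cube_nonempty finite_cube])
  also have "real (card (cube m \<inter> {x. F x = G x})) = (\<Sum>x\<in>cube m. of_bool (F x = G x))"
    by (simp add: of_bool_def sum.If_cases finite_cube Int_def)
  also have "\<dots> = (\<Sum>Z\<in>Pow {..<m}. of_bool (F (point m Z) = G (point m Z)))"
    by (rule sum.reindex_bij_betw[OF bij_betw_point, symmetric])
  finally show ?thesis
    by (simp add: card_cube)
qed

lemma sum_Pow_halves:
  fixes f :: "nat set \<Rightarrow> 'a :: comm_monoid_add"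
  shows "(\<Sum>Z\<in>Pow {..<2 * n}. f Z) = (\<Sum>X\<in>Pow {..<n}. \<Sum>Y\<in>Pow {n..<2 * n}. f (X \<union> Y))"
proof -
  have halves: "{..<2 * n} = {..<n} \<union> {n..<2 * n}" by auto
  show ?thesis
    unfolding halves by (rule sum_Pow_Un) auto
qed

lemma mleval_point:
  assumes "Z \<subseteq> {..<m}"
  shows "mleval m k c (point m Z) = (\<Sum>S\<in>Pow Z. c S) mod 2 ^ k"
proof -
  have "(\<Sum>S\<in>Pow {..<m}. c S * (\<Prod>i\<in>S. point m Z i)) = (\<Sum>S\<in>Pow {..<m}. if S \<in> Pow Z then c S else 0)"
  proof (rule sum.cong[OF refl])
    fix S assume S: "S \<in> Pow {..<m}"
    then have finS: "finite S"
      using finite_subset by blast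
    show "c S * (\<Prod>i\<in>S. point m Z i) = (if S \<in> Pow Z then c S else 0)"
    proof (cases "S \<subseteq> Z")
      case True
      then have "(\<Prod>i\<in>S. point m Z i) = 1"
        using assms by (intro prod.neutral) (auto simp: point_def)
      then show ?thesis using True by simp
    next
      case False
      then obtain i where "i \<in> S" "i \<notin> Z" by blast
      then have "(\<Prod>i\<in>S. point m Z i) = 0"
        using S finS by (intro prod_zero) (auto simp: point_def)
      then show ?thesis using False by simp
    qed
  qed
  also have "\<dots> = (\<Sum>S\<in>Pow {..<m} \<inter> Pow Z. c S)"
    by (rule sum.inter_restrict[symmetric]) simp
  also have "Pow {..<m} \<inter> Pow Z = Pow Z"
    using assms by auto
  finally show ?thesis
    by (simp add: mleval_def)
qed

lemma mleval_point_halves: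
  assumes "X \<subseteq> {..<n}" "Y \<subseteq> {n..<2 * n}"
  shows "mleval (2 * n) k c (point (2 * n) (X \<union> Y)) =
    (\<Sum>S\<in>Pow X. \<Sum>T\<in>Pow Y. c (S \<union> T)) mod 2 ^ k"
proof -
  have "{..<n} \<inter> {n..<2 * n} = {}" by auto
  then have "X \<inter> Y = {}"
    using assms by blast
  moreover have "X \<union> Y \<subseteq> {..<2 * n}" "finite X" "finite Y"
    using assms by (auto intro: finite_subset)
  ultimately show ?thesis
    by (simp add: mleval_point sum_Pow_Un)
qed

text \<open>The function \<open>F\<close>: at a point of weight \<open>u\<close> the elementary
  symmetric polynomial of degree \<open>e\<close> takes the value \<open>u choose e\<close>.\<close>

definition sym_fun :: "nat \<Rightarrow> nat \<Rightarrow> (nat \<Rightarrow> int) \<Rightarrow> int" where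
  "sym_fun d n x =
    (let u = card {i. i < n \<and> x i = 1}; v = card {i. n \<le> i \<and> i < 2 * n \<and> x i = 1}
     in of_nat ((u choose d) * (v choose (2 * d)) + (u choose (2 * d)) * (v choose d)) mod 2)"

lemma sym_fun_point:
  assumes "X \<subseteq> {..<n}" "Y \<subseteq> {n..<2 * n}"
  shows "sym_fun d n (point (2 * n) (X \<union> Y)) =
    of_nat ((card X choose d) * (card Y choose (2 * d)) + (card X choose (2 * d)) * (card Y choose d)) mod 2"
proof -
  have "{i. i < n \<and> point (2 * n) (X \<union> Y) i = 1} = X"
    using assms by (auto simp: point_def)
  moreover have "{i. n \<le> i \<and> i < 2 * n \<and> point (2 * n) (X \<union> Y) i = 1} = Y"
    using assms by (auto simp: point_def)
  ultimately show ?thesis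
    by (simp add: sym_fun_def Let_def)
qed

section \<open>Agreement with polynomials over the two-element field\<close>

lemma sum_Pow_card_eq:
  assumes "finite X"
  shows "(\<Sum>S\<in>Pow X. of_bool (card S = d)) = (of_nat (card X choose d) :: 'a :: comm_semiring_1)"
proof -
  have "(\<Sum>S\<in>Pow X. of_bool (card S = d) :: 'a) = of_nat (card {S. S \<subseteq> X \<and> card S = d})"
    using assms by (simp add: of_bool_def sum.If_cases Collect_conj_eq Pow_def)
  then show ?thesis
    by (simp add: n_subsets[OF assms])
qed

lemma gamma_sym_fun_le:
  fixes \<epsilon> :: real and m :: nat
  defines "d \<equiv> 2 ^ m"
  assumes "0 < \<epsilon>"
  shows "\<exists>N. \<forall>n\<ge>N. gamma (2 * n) (3 * d - 1) 1 (sym_fun d n) \<le> 5 / 8 + \<epsilon>"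
proof -
  have d: "0 < d" by (simp add: d_def)
  obtain N where N: "\<forall>(A :: nat set) (B :: nat set) c. finite A \<and> finite B \<and> N \<le> card A \<and> N \<le> card B \<and>
      leading d A B c \<longrightarrow> bias A B c \<le> 1 / 4 + \<epsilon>"
    using leading_bias_le[OF assms(2), of m, folded d_def] by (rule exE)
  have agr_le: "agr (2 * n) (lift 1 (sym_fun d n)) (mleval (2 * n) 1 Q) \<le> 5 / 8 + \<epsilon>"
    if n: "N \<le> n" and Q: "Q \<in> mlpolys (2 * n) (3 * d - 1) 1" for n Q
  proof -
    let ?A = "{..<n}" and ?B = "{n..<2 * n}"
    define s :: "nat set \<Rightarrow> nat set \<Rightarrow> nat" where
      "s S T = of_bool (card S = d) * of_bool (card T = 2 * d) +
        of_bool (card S = 2 * d) * of_bool (card T = d)" for S T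
    \<comment> \<open>The coefficients of \<open>F + Q\<close>: \<open>s\<close> is the coefficient
      function of \<open>F\<close>, and \<open>nat\<close> is harmless because those of
      \<open>Q\<close> are nonnegative residues.\<close>
    define c where "c S T = nat (Q (S \<union> T)) + s S T" for S T
    have Q_nonneg: "0 \<le> Q S" for S
      using Q by (auto simp: mlpolys_def)
    have "leading d ?A ?B c"
      unfolding leading_def
    proof (intro allI impI, elim conjE)
      fix S T assume ST: "S \<subseteq> ?A" "T \<subseteq> ?B" "3 * d \<le> card S + card T"
      have "?A \<inter> ?B = {}" by auto
      then have "S \<inter> T = {}"
        using ST by blast
      moreover have "finite S" "finite T"
        using ST by (auto intro: finite_subset)
      ultimately have "card (S \<union> T) = card S + card T"
        by (simp add: card_Un_disjoint)
      then have "\<not> card (S \<union> T) \<le> 3 * d - 1"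
        using ST(3) d by simp
      then have "Q (S \<union> T) = 0"
        using Q unfolding mlpolys_def by blast
      then show "odd (c S T) \<longleftrightarrow> (card S, card T) \<in> {(d, 2 * d), (2 * d, d)}"
        using d by (auto simp: c_def s_def)
    qed
    then have bias: "bias ?A ?B c \<le> 1 / 4 + \<epsilon>"
      using N n by simp
    have eq: "of_bool (lift 1 (sym_fun d n) (point (2 * n) (X \<union> Y)) = mleval (2 * n) 1 Q (point (2 * n) (X \<union> Y)))
        = (1 + (- 1) ^ peval c X Y) / (2 :: real)" if XY: "X \<subseteq> ?A" "Y \<subseteq> ?B" for X Y
    proof -
      define P where "P = (\<Sum>S\<in>Pow X. \<Sum>T\<in>Pow Y. nat (Q (S \<union> T)))"
      define a where "a = (card X choose d) * (card Y choose (2 * d)) + (card X choose (2 * d)) * (card Y choose d)"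
      have fXY: "finite X" "finite Y"
        using XY by (auto intro: finite_subset)
      have "(\<Sum>S\<in>Pow X. \<Sum>T\<in>Pow Y. s S T) = a"
        by (simp only: s_def a_def sum.distrib sum_product[symmetric] sum_Pow_card_eq[OF fXY(1)]
            sum_Pow_card_eq[OF fXY(2)] of_nat_id)
      then have ev: "peval c X Y = P + a"
        by (simp add: peval_def c_def P_def sum.distrib)
      have "lift 1 (sym_fun d n) (point (2 * n) (X \<union> Y)) = int a mod 2"
        unfolding lift_def sym_fun_point[OF XY] a_def[symmetric] by auto
      moreover have "mleval (2 * n) 1 Q (point (2 * n) (X \<union> Y)) = int P mod 2"
        by (simp add: mleval_point_halves[OF XY] P_def Q_nonneg)
      moreover have "int a mod 2 = int P mod 2 \<longleftrightarrow> even (P + a)"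
        by presburger
      ultimately show ?thesis
        by (simp add: ev minus_one_power_iff)
    qed
    have "agr (2 * n) (lift 1 (sym_fun d n)) (mleval (2 * n) 1 Q) =
        (\<Sum>X\<in>Pow ?A. \<Sum>Y\<in>Pow ?B. (1 + (- 1) ^ peval c X Y) / 2) / 2 ^ (2 * n)"
      unfolding agr_eq_sum sum_Pow_halves
      by (intro arg_cong2[where f = "(/)"] sum.cong refl eq) auto
    also have "\<dots> = 1 / 2 + bias ?A ?B c / 2"
    proof -
      have card: "card ?A + card ?B = 2 * n" by simp
      have "(\<Sum>X\<in>Pow ?A. \<Sum>Y\<in>Pow ?B. (1 + (- 1) ^ peval c X Y) / (2 :: real)) =
          (2 ^ (2 * n) + (\<Sum>X\<in>Pow ?A. \<Sum>Y\<in>Pow ?B. (- 1) ^ peval c X Y)) / 2"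
        by (simp add: sum.distrib card_Pow mult_2 power_add flip: sum_divide_distrib)
      then show ?thesis
        unfolding bias_def card by (simp add: add_divide_distrib)
    qed
    also have "\<dots> \<le> 5 / 8 + \<epsilon>"
      using bias assms(2) by simp
    finally show ?thesis .
  qed
  show ?thesis
    unfolding gamma_def
    by (intro exI[of _ N] allI impI Max.boundedI) (use agr_le finite_mlpolys mlpolys_nonempty in auto)
qed

section \<open>Agreement with a polynomial modulo 4\<close>

definition odd_density :: "nat \<Rightarrow> nat \<Rightarrow> real" where
  "odd_density d n = (\<Sum>X\<in>Pow {..<n}. of_bool (odd (card X choose d))) / 2 ^ n"

text \<open>The parity is a binary digit of the weight; it has period \<open>2 * d\<close> and
  equals 1 on half of the residues.\<close>

lemma odd_density_tendsto:
  fixes m :: nat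
  defines "d \<equiv> 2 ^ m"
  shows "odd_density d \<longlonglongrightarrow> 1 / 2"
proof -
  define h :: "nat \<Rightarrow> real" where "h k = of_bool (odd (k choose d))" for k
  have d: "0 < d" by (simp add: d_def)
  have h: "h k = of_bool (odd (k div d))" for k
    unfolding h_def d_def choose_power2_parity ..
  have "(k mod (2 * d)) div d mod 2 = k div d mod 2" for k
    by (simp add: mult.commute[of 2] mod_mult2_eq d)
  then have periodic: "h (k mod (2 * d)) = h k" for k
    unfolding h by (simp add: odd_iff_mod_2_eq_one)
  have "odd_density d = (\<lambda>n. \<Sum>\<rho><2 * d. resid (2 * d) n \<rho> * h \<rho>)"
  proof
    fix n
    show "odd_density d n = (\<Sum>\<rho><2 * d. resid (2 * d) n \<rho> * h \<rho>)"
      using sum_Pow_card_periodic[of "{..<n}" "2 * d" h] periodic d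
      by (simp add: odd_density_def h_def)
  qed
  moreover have "(\<lambda>n. \<Sum>\<rho><2 * d. resid (2 * d) n \<rho> * h \<rho>) \<longlonglongrightarrow> (\<Sum>\<rho><2 * d. 1 / real (2 * d) * h \<rho>)"
    by (intro tendsto_sum tendsto_mult tendsto_const resid_tendsto) auto
  moreover have "(\<Sum>\<rho><2 * d. 1 / real (2 * d) * h \<rho>) = 1 / 2"
  proof -
    have "(\<Sum>\<rho><2 * d. h \<rho>) = (\<Sum>l<d. \<Sum>k<2. h (l + d * k))"
      by (simp only: mult.commute[of 2] sum_lessThan_mult)
    also have "\<dots> = (\<Sum>l<d. 1)"
    proof (rule sum.cong[OF refl])
      fix l assume "l \<in> {..<d}"
      then have "(l + d * k) div d = k" for k
        by simp
      then show "(\<Sum>k<2. h (l + d * k)) = 1"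
        by (simp add: h numeral_2_eq_2 del: div_mult_self2)
    qed
    finally show ?thesis
      using d by (simp only: sum_distrib_left[symmetric]) simp
  qed
  ultimately show ?thesis
    by (simp only:)
qed

lemma gamma_sym_fun_ge:
  fixes m :: nat
  defines "d \<equiv> 2 ^ m"
  shows "gamma (2 * n) (2 * d) 2 (sym_fun d n) \<ge> 1 - (odd_density d n)\<^sup>2"
proof -
  let ?A = "{..<n}" and ?B = "{n..<2 * n}"
  \<comment> \<open>The product of the elementary symmetric polynomials of degree \<open>d\<close>
    in the two halves.\<close>
  define Q :: "nat set \<Rightarrow> int" where
    "Q S = of_bool (S \<subseteq> {..<2 * n}) * (of_bool (card (S \<inter> ?A) = d) * of_bool (card (S \<inter> ?B) = d))" for S
  have "Q \<in> mlpolys (2 * n) (2 * d) 2"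
    unfolding mlpolys_def
  proof (intro CollectI conjI allI impI)
    fix S
    show "Q S \<in> {0..<2 ^ 2}" by (simp add: Q_def)
    assume "Q S \<noteq> 0"
    then have S: "S \<subseteq> {..<2 * n}" "card (S \<inter> ?A) = d" "card (S \<inter> ?B) = d"
      by (auto simp: Q_def)
    show "S \<subseteq> {..<2 * n}" by (rule S(1))
    have "S = (S \<inter> ?A) \<union> (S \<inter> ?B)"
      using S(1) by auto
    then have "card S \<le> card (S \<inter> ?A) + card (S \<inter> ?B)"
      by (metis card_Un_le)
    then show "card S \<le> 2 * d" using S by simp
  qed
  then have "gamma (2 * n) (2 * d) 2 (sym_fun d n) \<ge> agr (2 * n) (lift 2 (sym_fun d n)) (mleval (2 * n) 2 Q)"
    unfolding gamma_def by (intro Max_ge) (auto simp: finite_mlpolys)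
  moreover have "agr (2 * n) (lift 2 (sym_fun d n)) (mleval (2 * n) 2 Q) \<ge>
      (\<Sum>X\<in>Pow ?A. \<Sum>Y\<in>Pow ?B. 1 - of_bool (odd (card X choose d)) * of_bool (odd (card Y choose d))) / 2 ^ (2 * n)"
    unfolding agr_eq_sum sum_Pow_halves
  proof (intro divide_right_mono sum_mono)
    fix X Y assume "X \<in> Pow ?A" "Y \<in> Pow ?B"
    then have XY: "X \<subseteq> ?A" "Y \<subseteq> ?B" by auto
    then have fXY: "finite X" "finite Y"
      by (auto intro: finite_subset)
    define a a' b b' where "a = card X choose d" and "a' = card X choose (2 * d)"
      and "b = card Y choose d" and "b' = card Y choose (2 * d)"
    have "(\<Sum>S\<in>Pow X. \<Sum>T\<in>Pow Y. Q (S \<union> T)) =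
        (\<Sum>S\<in>Pow X. \<Sum>T\<in>Pow Y. of_bool (card S = d) * of_bool (card T = d))"
    proof (intro sum.cong refl)
      fix S T assume "S \<in> Pow X" "T \<in> Pow Y"
      then have "S \<subseteq> ?A" "T \<subseteq> ?B" using XY by auto
      then have "S \<union> T \<subseteq> {..<2 * n}" "(S \<union> T) \<inter> ?A = S" "(S \<union> T) \<inter> ?B = T"
        by auto
      then show "Q (S \<union> T) = of_bool (card S = d) * of_bool (card T = d)"
        by (simp add: Q_def)
    qed
    also have "\<dots> = int (a * b)"
      by (simp only: a_def b_def sum_product[symmetric] sum_Pow_card_eq[OF fXY(1)]
          sum_Pow_card_eq[OF fXY(2)] of_nat_mult)
    finally have ev: "mleval (2 * n) 2 Q (point (2 * n) (X \<union> Y)) = int (a * b mod 4)"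
      by (simp add: mleval_point_halves[OF XY] zmod_int)
    define s where "s = a * b' + a' * b"
    have "sym_fun d n (point (2 * n) (X \<union> Y)) = int s mod 2"
      unfolding sym_fun_point[OF XY] s_def a_def a'_def b_def b'_def ..
    moreover have "int s mod 2 = 0 \<longleftrightarrow> even s"
      by presburger
    ultimately have lift: "lift 2 (sym_fun d n) (point (2 * n) (X \<union> Y)) = (if even s then 0 else 2)"
      by (simp add: lift_def)
    \<comment> \<open>If \<open>a\<close> is even, then \<open>a * b\<close> is
      \<open>2 * a' * b\<close> modulo 4 and \<open>s\<close> has the parity of
      \<open>a' * b\<close>; the case of even \<open>b\<close> is symmetric. If both are odd, the
      lower bound for this point is 0.\<close>
    have "a * b mod 4 = (if even s then 0 else 2)" if "even a \<or> even b"
    proof -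
      have a: "[a = 2 * a'] (mod 4)" if "even a"
        using even_choose_power2_mod_4[of "card X" m] that by (simp add: a_def a'_def d_def)
      have b: "[b = 2 * b'] (mod 4)" if "even b"
        using even_choose_power2_mod_4[of "card Y" m] that by (simp add: b_def b'_def d_def)
      have two: "2 * k mod 4 = (if even k then 0 else 2)" for k :: nat
        by presburger
      have ab: "[a * b = 2 * (a' * b)] (mod 4)" if "even a"
        using cong_mult[OF a[OF that] cong_refl[of b]] by (simp add: mult_ac)
      have ba: "[a * b = 2 * (a * b')] (mod 4)" if "even b"
        using cong_mult[OF cong_refl[of a] b[OF that]] by (simp add: mult_ac)
      show ?thesis
      proof (cases "even a")
        case True
        then show ?thesis
          using ab two[of "a' * b"] True by (simp add: cong_def s_def)
      next
        case False
        then have "even b" using that by simp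
        then show ?thesis
          using ba two[of "a * b'"] by (simp add: cong_def s_def)
      qed
    qed
    then show "1 - of_bool (odd (card X choose d)) * of_bool (odd (card Y choose d)) \<le>
        (of_bool (lift 2 (sym_fun d n) (point (2 * n) (X \<union> Y)) =
          mleval (2 * n) 2 Q (point (2 * n) (X \<union> Y))) :: real)"
      unfolding ev lift a_def[symmetric] b_def[symmetric] by auto
  qed simp
  moreover have "(\<Sum>X\<in>Pow ?A. \<Sum>Y\<in>Pow ?B. 1 - of_bool (odd (card X choose d)) * of_bool (odd (card Y choose d))) /
      2 ^ (2 * n) = 1 - (odd_density d n)\<^sup>2"
  proof -
    define \<alpha> :: real where "\<alpha> = (\<Sum>X\<in>Pow ?A. of_bool (odd (card X choose d)))"
    have card: "card ?B = card ?A" by simp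
    have "(\<Sum>Y\<in>Pow ?B. of_bool (odd (card Y choose d)) :: real) = \<alpha>"
      unfolding \<alpha>_def
      by (simp only: sum_Pow_card[OF finite_atLeastLessThan, where h = "\<lambda>k. of_bool (odd (k choose d))"]
          sum_Pow_card[OF finite_lessThan, where h = "\<lambda>k. of_bool (odd (k choose d))"] card)
    then have "(\<Sum>X\<in>Pow ?A. \<Sum>Y\<in>Pow ?B. 1 - of_bool (odd (card X choose d)) * of_bool (odd (card Y choose d)) :: real) =
        (\<Sum>X\<in>Pow ?A. \<Sum>Y\<in>Pow ?B. 1) - \<alpha> * \<alpha>"
      by (simp only: sum_subtractf sum_product[symmetric] \<alpha>_def)
    also have "\<dots> = 2 ^ (2 * n) - \<alpha> * \<alpha>"
      by (simp add: card_Pow mult_2 power_add)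
    also have "\<dots> / 2 ^ (2 * n) = 1 - (odd_density d n)\<^sup>2"
      by (simp add: odd_density_def \<alpha>_def[symmetric] diff_divide_distrib power2_eq_square mult_2 power_add)
    finally show ?thesis .
  qed
  ultimately show ?thesis
    by linarith
qed

theorem theorem3p4:
  fixes d :: nat
  assumes "\<exists>j. d = 2 ^ j"
  shows "\<exists>\<epsilon> \<delta> :: nat \<Rightarrow> real. \<epsilon> \<longlonglongrightarrow> 0 \<and> \<delta> \<longlonglongrightarrow> 0 \<and>
    (\<exists>N. \<forall>n\<ge>N. \<exists>F \<in> cube (2 * n) \<rightarrow> {0, 1}.
        gamma (2 * n) (2 * d) 2 F \<ge> 3 / 4 - \<epsilon> n \<and>
        gamma (2 * n) (3 * d - 1) 1 F \<le> 5 / 8 + \<delta> n)"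
proof -
  obtain m where m: "d = 2 ^ m"
    using assms by blast
  \<comment> \<open>Chosen so that \<open>3 / 4 - \<epsilon> n\<close> is exactly the bound of
    \<open>gamma_sym_fun_ge\<close>. Likewise \<open>\<delta>\<close> is the actual excess over
    \<open>5 / 8\<close>, cut off at 0, so both inequalities hold for every \<open>n\<close> and
    only the limits need proof.\<close>
  define \<epsilon> where "\<epsilon> n = (odd_density d n)\<^sup>2 - 1 / 4" for n
  define \<delta> where "\<delta> n = max 0 (gamma (2 * n) (3 * d - 1) 1 (sym_fun d n) - 5 / 8)" for n
  have "(\<lambda>n. (odd_density d n)\<^sup>2 - 1 / 4) \<longlonglongrightarrow> (1 / 2)\<^sup>2 - 1 / 4"
    unfolding m by (intro tendsto_intros odd_density_tendsto)
  then have "\<epsilon> \<longlonglongrightarrow> 0"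
    by (simp add: \<epsilon>_def[abs_def] power2_eq_square)
  moreover have "\<delta> \<longlonglongrightarrow> 0"
  proof (rule LIMSEQ_I)
    fix r :: real assume "0 < r"
    then obtain N where N: "\<forall>n\<ge>N. gamma (2 * n) (3 * d - 1) 1 (sym_fun d n) \<le> 5 / 8 + r / 2"
      using gamma_sym_fun_le[of "r / 2" m] m by auto
    show "\<exists>N. \<forall>n\<ge>N. norm (\<delta> n - 0) < r"
    proof (intro exI[of _ N] allI impI)
      fix n assume "N \<le> n"
      then have "gamma (2 * n) (3 * d - 1) 1 (sym_fun d n) \<le> 5 / 8 + r / 2"
        using N by blast
      then show "norm (\<delta> n - 0) < r"
        using \<open>0 < r\<close> by (simp add: \<delta>_def)
    qed
  qed
  moreover have "\<exists>F \<in> cube (2 * n) \<rightarrow> {0, 1}. gamma (2 * n) (2 * d) 2 F \<ge> 3 / 4 - \<epsilon> n \<and>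
      gamma (2 * n) (3 * d - 1) 1 F \<le> 5 / 8 + \<delta> n" for n
  proof (intro bexI conjI)
    show "sym_fun d n \<in> cube (2 * n) \<rightarrow> {0, 1}"
      by (auto simp: sym_fun_def Let_def)
    show "gamma (2 * n) (2 * d) 2 (sym_fun d n) \<ge> 3 / 4 - \<epsilon> n"
      using gamma_sym_fun_ge[of m n] by (simp add: \<epsilon>_def m)
    show "gamma (2 * n) (3 * d - 1) 1 (sym_fun d n) \<le> 5 / 8 + \<delta> n"
      by (simp add: \<delta>_def)
  qed
  ultimately show ?thesis
    by blast
qed

end
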